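(* Let $G$ be a torsion-free polycyclic group satisfying a short exact sequence $$1\to N\to G\to \mathbb{Z}^r\to 1,$$ where $N$ is finitely generated and nilpotent. If $N$ has upper exponential distortion in $G$, then any simple symmetric random walk on $G$ has escape exponent $1/2$.
   Context: Word lengths: for a finitely generated group $G$, a generating set means a finite subset closed under inversion which generates $G$ as a semigroup; $|\cdot|_G$ denotes the word length for some such generating set (the notions below do not depend on this choice). Upper exponential distortion: a finitely generated subgroup $H<G$ has upper exponential distortion in $G$ if there is $c>0$ such that $|h|_G\le c\log(|h|_H+1)+c$ for all $h\in H$. The trivial group is regarded as having upper exponential distortion. Simple symmetric random walk: $X_0=e$, $X_n=\xi_1\cdots\xi_n$ with $\xi_i$ i.i.d. of law $\mu$, where $\mu$ is supported on a finite generating set of $G$ and $\mu(g)=\mu(g^{-1})$ for all $g\in G$ (such a walk is also called adapted; the law need not be uniform on its support). Escape exponent: a random walk $X_n$ on $G$ with law $\mu$ has escape exponent $\alpha$ if all three of the following hold. (i) ($\alpha$-tight degree of escape) There exist $\gamma,\delta>0$ such that $P(|X_n|_G>\gamma n^\alpha)\ge\delta$ for all $n\ge 1$; and there exist $\beta,c,C>0$ such that $P(|X_n|_G>xn^\alpha)\le C\exp(-cx^\beta)$ for all $x\ge 0$ and all $n\ge 0$. (ii) (Displacement exponent $\alpha$) $\mathbb{E}_\mu|X_n|_G\simeq n^\alpha$, where for increasing functions $f\preceq g$ means there is $c>0$ with $f(x)\le c\,g(cx)$ for all $x$ (functions on $\mathbb{N}$ being extended continuously and piecewise linearly), and $f\simeq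 g$ means $f\preceq g$ and $g\preceq f$. (iii) ($\alpha$-law of iterated logarithm) $0<\limsup_{n\to\infty}\frac{|X_n|_G}{(n\log\log n)^\alpha}<\infty$ almost surely. *)

theory Defs
  imports "HOL-Algebra.Product_Groups" "HOL-Probability.Probability"
begin

definition torsion_free_group :: "('a, 'b) monoid_scheme \<Rightarrow> bool" where
  "torsion_free_group G \<longleftrightarrow>
     group G \<and> (\<forall>x\<in>carrier G. \<forall>n::nat. n > 0 \<and> x [^]\<^bsub>G\<^esub> n = \<one>\<^bsub>G\<^esub> \<longrightarrow> x = \<one>\<^bsub>G\<^esub>)"

definition polycyclic_group :: "('a, 'b) monoid_scheme \<Rightarrow> bool" where
  "polycyclic_group G \<longleftrightarrow> group G \<and>
     (\<exists>(n::nat) (H :: nat \<Rightarrow> 'a set). H 0 = {\<one>\<^bsub>G\<^esub>} \<and> H n = carrier G \<and>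
        (\<forall>i\<le>n. subgroup (H i) G) \<and>
        (\<forall>i<n. H i \<lhd> (G\<lparr>carrier := H (Suc i)\<rparr>) \<and>
                cyclic_group (G\<lparr>carrier := H (Suc i)\<rparr> Mod H i)))"

primrec lower_central :: "('a, 'b) monoid_scheme \<Rightarrow> nat \<Rightarrow> 'a set" where
  "lower_central G 0 = carrier G"
| "lower_central G (Suc k) =
     generate G {x \<otimes>\<^bsub>G\<^esub> y \<otimes>\<^bsub>G\<^esub> inv\<^bsub>G\<^esub> x \<otimes>\<^bsub>G\<^esub> inv\<^bsub>G\<^esub> y |x y. x \<in> lower_central G k \<and> y \<in> carrier G}"

definition nilpotent_group :: "('a, 'b) monoid_scheme \<Rightarrow> bool" where
  "nilpotent_group G \<longleftrightarrow> group G \<and> (\<exists>k. lower_central G k = {\<one>\<^bsub>G\<^esub>})"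

definition word_prod :: "('a, 'b) monoid_scheme \<Rightarrow> 'a list \<Rightarrow> 'a" where
  "word_prod G ws = foldr (\<lambda>x y. x \<otimes>\<^bsub>G\<^esub> y) ws \<one>\<^bsub>G\<^esub>"

(* Generation as a semigroup: products of nonempty words. *)
definition generating_set :: "('a, 'b) monoid_scheme \<Rightarrow> 'a set \<Rightarrow> bool" where
  "generating_set G S \<longleftrightarrow> finite S \<and> S \<subseteq> carrier G \<and> (\<forall>s\<in>S. inv\<^bsub>G\<^esub> s \<in> S) \<and>
     (\<forall>g\<in>carrier G. \<exists>ws. ws \<noteq> [] \<and> set ws \<subseteq> S \<and> word_prod G ws = g)"

definition finitely_generated_group :: "('a, 'b) monoid_scheme \<Rightarrow> bool" where
  "finitely_generated_group G \<longleftrightarrow> group G \<and> (\<exists>S. generating_set G S)"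

(* The identity has length 0 (empty word). *)
definition word_length :: "('a, 'b) monoid_scheme \<Rightarrow> 'a set \<Rightarrow> 'a \<Rightarrow> nat" where
  "word_length G S g = (LEAST n. \<exists>ws. length ws = n \<and> set ws \<subseteq> S \<and> word_prod G ws = g)"

definition upper_exp_distortion :: "'a set \<Rightarrow> ('a, 'b) monoid_scheme \<Rightarrow> bool" where
  "upper_exp_distortion H G \<longleftrightarrow> subgroup H G \<and>
     (\<exists>S T. generating_set G S \<and> generating_set (G\<lparr>carrier := H\<rparr>) T \<and>
        (\<exists>c>0. \<forall>h\<in>H. real (word_length G S h) \<le>
            c * ln (real (word_length (G\<lparr>carrier := H\<rparr>) T h) + 1) + c))"

definition simple_symmetric_law :: "('a, 'b) monoid_scheme \<Rightarrow> 'a pmf \<Rightarrow> bool" where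
  "simple_symmetric_law G \<mu> \<longleftrightarrow>
     generating_set G (set_pmf \<mu>) \<and> (\<forall>g\<in>carrier G. pmf \<mu> g = pmf \<mu> (inv\<^bsub>G\<^esub> g))"

(* W is the walk with i.i.d. increments xi 1, xi 2, ... of law mu, on an arbitrary probability
   space. The increments are measurable into count_space (carrier G), hence take values in G
   everywhere on space M; as G is countable, point masses determine the law. *)
definition random_walk ::
    "('a, 'b) monoid_scheme \<Rightarrow> 'a pmf \<Rightarrow> 'w measure \<Rightarrow> (nat \<Rightarrow> 'w \<Rightarrow> 'a) \<Rightarrow> bool" where
  "random_walk G \<mu> M W \<longleftrightarrow> prob_space M \<and>
     (\<exists>\<xi> :: nat \<Rightarrow> 'w \<Rightarrow> 'a.
        prob_space.indep_vars M (\<lambda>_. count_space (carrier G)) \<xi> {1..} \<and>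
        (\<forall>i\<ge>1. \<forall>g\<in>carrier G. measure M {\<omega> \<in> space M. \<xi> i \<omega> = g} = pmf \<mu> g) \<and>
        (\<forall>n. \<forall>\<omega>\<in>space M. W n \<omega> = word_prod G (map (\<lambda>i. \<xi> i \<omega>) [1..<Suc n])))"

definition tight_degree_of_escape :: "'w measure \<Rightarrow> (nat \<Rightarrow> 'w \<Rightarrow> nat) \<Rightarrow> real \<Rightarrow> bool" where
  "tight_degree_of_escape M L \<alpha> \<longleftrightarrow>
     (\<exists>\<gamma>>0. \<exists>\<delta>>0. \<forall>n\<ge>1.
        measure M {\<omega> \<in> space M. real (L n \<omega>) > \<gamma> * real n powr \<alpha>} \<ge> \<delta>) \<and>
     (\<exists>\<beta>>0. \<exists>c>0. \<exists>C>0. \<forall>x\<ge>0. \<forall>n.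
        measure M {\<omega> \<in> space M. real (L n \<omega>) > x * real n powr \<alpha>} \<le> C * exp (- c * x powr \<beta>))"

(* Continuous piecewise linear extension of f from the naturals to [0, infinity). *)
definition pl_ext :: "(nat \<Rightarrow> real) \<Rightarrow> real \<Rightarrow> real" where
  "pl_ext f x = f (nat \<lfloor>x\<rfloor>) + (x - of_int \<lfloor>x\<rfloor>) * (f (Suc (nat \<lfloor>x\<rfloor>)) - f (nat \<lfloor>x\<rfloor>))"

definition growth_le :: "(nat \<Rightarrow> real) \<Rightarrow> (nat \<Rightarrow> real) \<Rightarrow> bool" where
  "growth_le f g \<longleftrightarrow> (\<exists>c>0. \<forall>x\<ge>0. pl_ext f x \<le> c * pl_ext g (c * x))"

definition growth_equiv :: "(nat \<Rightarrow> real) \<Rightarrow> (nat \<Rightarrow> real) \<Rightarrow> bool" where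
  "growth_equiv f g \<longleftrightarrow> growth_le f g \<and> growth_le g f"

definition displacement_exponent :: "'w measure \<Rightarrow> (nat \<Rightarrow> 'w \<Rightarrow> nat) \<Rightarrow> real \<Rightarrow> bool" where
  "displacement_exponent M L \<alpha> \<longleftrightarrow>
     growth_equiv (\<lambda>n. LINT \<omega>|M. real (L n \<omega>)) (\<lambda>n. real n powr \<alpha>)"

definition law_of_iterated_log :: "'w measure \<Rightarrow> (nat \<Rightarrow> 'w \<Rightarrow> nat) \<Rightarrow> real \<Rightarrow> bool" where
  "law_of_iterated_log M L \<alpha> \<longleftrightarrow>
     (AE \<omega> in M.
        0 < limsup (\<lambda>n. ereal (real (L n \<omega>) / (real n * ln (ln (real n))) powr \<alpha>)) \<and>
        limsup (\<lambda>n. ereal (real (L n \<omega>) / (real n * ln (ln (real n))) powr \<alpha>)) < \<infinity>)"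

definition escape_exponent ::
    "('a, 'b) monoid_scheme \<Rightarrow> 'a set \<Rightarrow> 'w measure \<Rightarrow> (nat \<Rightarrow> 'w \<Rightarrow> 'a) \<Rightarrow> real \<Rightarrow> bool" where
  "escape_exponent G S M W \<alpha> \<longleftrightarrow>
     tight_degree_of_escape M (\<lambda>n \<omega>. word_length G S (W n \<omega>)) \<alpha> \<and>
     displacement_exponent M (\<lambda>n \<omega>. word_length G S (W n \<omega>)) \<alpha> \<and>
     law_of_iterated_log M (\<lambda>n \<omega>. word_length G S (W n \<omega>)) \<alpha>"

end

theory Submission
  imports Defs "HOL-Algebra.Multiplicative_Group" "HOL-Real_Asymp.Real_Asymp"
begin

text \<open>
  Write \<open>\<tau>(v) = a\<^sub>0\<^bsup>v\<^sub>0\<^esup> \<dots> a\<^bsub>r-1\<^esub>\<^bsup>v\<^bsub>r-1\<^esub>\<^esup>\<close> for lifts \<open>a\<^sub>j\<close> of the standard basis of \<open>\<int>\<^sup>r\<close>, and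
  let \<open>v\<^sub>i\<close> be the image of \<open>X\<^sub>i\<close> in \<open>\<int>\<^sup>r\<close>. Then \<open>X\<^sub>n \<tau>(v\<^sub>n)\<^sup>-\<^sup>1\<close> is the product of the elements
  \<open>\<tau>(v\<^bsub>i-1\<^esub>) \<xi>\<^sub>i \<tau>(v\<^sub>i)\<^sup>-\<^sup>1\<close> of \<open>N\<close>. Conjugation by a generator of \<open>G\<close> is Lipschitz on \<open>N\<close>, so each of
  them has \<open>N\<close>-length at most exponential in \<open>R = max |v\<^sub>i|\<close>, and upper exponential distortion turns
  the \<open>N\<close>-length of the product into \<open>|X\<^sub>n| \<le> C (R + ln (n + 1) + 1)\<close>. Conversely, \<open>|X\<^sub>n|\<close> dominates
  every coordinate of \<open>v\<^sub>n\<close>. So \<open>|X\<^sub>n|\<close> lies between one coordinate and the running maximum of finitely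
  many one-dimensional symmetric walks with bounded steps, up to constants and a logarithm: the upper
  tails come from a maximal Hoeffding bound, the lower ones from the Paley--Zygmund inequality, and the
  iterated logarithm from the two Borel--Cantelli lemmas along the blocks \<open>(2\<^sup>j, 2\<^sup>j\<^sup>+\<^sup>1]\<close>.
  If \<open>r = 0\<close>, then \<open>N = G\<close> and the distortion bound makes \<open>G\<close> finite, hence trivial.
\<close>

section \<open>Word length\<close>

text \<open>The map \<tau> is not a homomorphism, and its defect consists of commutators of long
  elements, whose \<open>N\<close>-length is bounded only exponentially. This loss is harmless: the
  logarithm in the distortion bound turns an exponential of R back into R. Each factor depends on
  the point from which its step starts, so the deterministic estimate needs a bound along all
  prefixes; this is why running maxima, and not end points, appear on the probabilistic side. The
  number of factors contributes only ln n, negligible against both n^(1/2) and (n ln ln n)^(1/2).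
  The coordinates of the walk may depend on each other: upper bounds use a union over the
  coordinates, lower bounds a single coordinate. Probabilities are computed in finite products of
  the step law, where expectations are finite sums and conditioning on the first letters is a plain
  recursion.\<close>

context group
begin

lemma inv_cancel_left:
  assumes "x \<in> carrier G" "y \<in> carrier G"
  shows "inv x \<otimes> (x \<otimes> y) = y" "x \<otimes> (inv x \<otimes> y) = y"
  using assms by (simp_all flip: m_assoc)

lemma word_prod_Nil [simp]: "word_prod G [] = \<one>"
  by (simp add: word_prod_def)

lemma word_prod_Cons [simp]: "word_prod G (x # xs) = x \<otimes> word_prod G xs"
  by (simp add: word_prod_def)

lemma word_prod_closed [simp, intro]: "set ws \<subseteq> carrier G \<Longrightarrow> word_prod G ws \<in> carrier G"
  by (induction ws) auto

lemma word_prod_append: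
  "set us \<subseteq> carrier G \<Longrightarrow> set vs \<subseteq> carrier G \<Longrightarrow>
    word_prod G (us @ vs) = word_prod G us \<otimes> word_prod G vs"
  by (induction us) (auto simp: m_assoc)

lemma inv_word_prod:
  "set ws \<subseteq> carrier G \<Longrightarrow> inv (word_prod G ws) = word_prod G (map (m_inv G) (rev ws))"
proof (induction ws)
  case (Cons x ws)
  then have "word_prod G (map (m_inv G) (rev ws) @ [inv x]) = inv (word_prod G ws) \<otimes> inv x"
    by (subst word_prod_append) auto
  then show ?case using Cons by (simp add: inv_mult_group)
qed simp

end

locale generated_group = group G for G (structure) +
  fixes S :: "'a set"
  assumes generating: "generating_set G S"
begin

abbreviation len :: "'a \<Rightarrow> nat" where "len g \<equiv> word_length G S g"

lemma finite_gens: "finite S" and gens_closed: "S \<subseteq> carrier G"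
  and gens_inv: "s \<in> S \<Longrightarrow> inv s \<in> S"
  using generating by (auto simp: generating_set_def)

lemma obtain_word:
  assumes "g \<in> carrier G"
  obtains ws where "length ws = len g" "set ws \<subseteq> S" "word_prod G ws = g"
proof -
  have "\<exists>n ws. length ws = n \<and> set ws \<subseteq> S \<and> word_prod G ws = g"
    using generating assms unfolding generating_set_def by blast
  from LeastI_ex[OF this] show ?thesis
    using that unfolding word_length_def by blast
qed

lemma len_le: "set ws \<subseteq> S \<Longrightarrow> len (word_prod G ws) \<le> length ws"
  unfolding word_length_def by (rule Least_le) blast

lemma len_one [simp]: "len \<one> = 0"
  using len_le[of "[]"] by simp

lemma len_gen: "s \<in> S \<Longrightarrow> len s \<le> 1"
  using len_le[of "[s]"] gens_closed by auto

lemma len_mult: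
  assumes "g \<in> carrier G" "h \<in> carrier G"
  shows "len (g \<otimes> h) \<le> len g + len h"
proof -
  obtain us where us: "length us = len g" "set us \<subseteq> S" "word_prod G us = g"
    using obtain_word assms by blast
  obtain vs where vs: "length vs = len h" "set vs \<subseteq> S" "word_prod G vs = h"
    using obtain_word assms by blast
  show ?thesis
    using len_le[of "us @ vs"] us vs word_prod_append[of us vs] gens_closed by auto
qed

lemma len_inv:
  assumes "g \<in> carrier G"
  shows "len (inv g) \<le> len g"
proof -
  obtain us where us: "length us = len g" "set us \<subseteq> S" "word_prod G us = g"
    using obtain_word assms by blast
  then show ?thesis
    using len_le[of "map (m_inv G) (rev us)"] inv_word_prod[of us] gens_inv gens_closed by auto
qed

lemma len_nat_pow: "g \<in> carrier G \<Longrightarrow> len (g [^] (n::nat)) \<le> n * len g"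
proof (induction n)
  case (Suc n)
  then show ?case using len_mult[of "g [^] n" g] by simp
qed simp

lemma len_int_pow:
  assumes "g \<in> carrier G"
  shows "len (g [^] (k::int)) \<le> nat \<bar>k\<bar> * len g"
proof (cases "k < 0")
  case True
  have "len (inv (g [^] nat (- k))) \<le> nat (- k) * len g"
    by (rule order.trans[OF len_inv len_nat_pow]) (use assms in auto)
  then show ?thesis using True by (simp only: int_pow_def2 if_True) simp
next
  case False
  then show ?thesis using len_nat_pow[of g "nat k"] assms by (simp only: int_pow_def2 if_False) simp
qed

text \<open>Split a shortest word for \<open>g\<close> into its letters. The bound serves to compare
  generating sets, to find the Lipschitz constant of conjugation on \<open>N\<close> and to dominate
  coordinates of the quotient. The case \<open>K = 0\<close> is useful too: \<open>f\<close>
  nonpositive on the generators is nonpositive everywhere.\<close>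

lemma subadditive_le_len:
  fixes f :: "'a \<Rightarrow> real"
  assumes one: "f \<one> \<le> 0"
    and mult: "\<And>g h. g \<in> carrier G \<Longrightarrow> h \<in> carrier G \<Longrightarrow> f (g \<otimes> h) \<le> f g + f h"
    and gens: "\<And>s. s \<in> S \<Longrightarrow> f s \<le> K"
    and g: "g \<in> carrier G"
  shows "f g \<le> K * real (len g)"
proof -
  have *: "f (word_prod G ws) \<le> K * real (length ws)" if "set ws \<subseteq> S" for ws
    using that
  proof (induction ws)
    case (Cons x xs)
    then have "f (x \<otimes> word_prod G xs) \<le> f x + f (word_prod G xs)"
      using gens_closed by (intro mult) auto
    then show ?case using Cons gens[of x] by (simp add: algebra_simps)
  qed (use one in simp)
  obtain ws where "length ws = len g" "set ws \<subseteq> S" "word_prod G ws = g"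
    using obtain_word g by blast
  then show ?thesis using *[of ws] by simp
qed

lemma ex_subadditive_le_len:
  fixes f :: "'a \<Rightarrow> real"
  assumes "f \<one> \<le> 0"
    and "\<And>g h. g \<in> carrier G \<Longrightarrow> h \<in> carrier G \<Longrightarrow> f (g \<otimes> h) \<le> f g + f h"
  obtains K where "K > 0" "\<And>g. g \<in> carrier G \<Longrightarrow> f g \<le> K * real (len g)"
proof -
  \<comment> \<open>A sum over the finite generating set replaces a maximum, here and in later
    constants; the summand 1 makes it positive whatever the values of \<open>f\<close>.\<close>
  define K where "K = 1 + (\<Sum>s\<in>S. \<bar>f s\<bar>)"
  have "f s \<le> K" if "s \<in> S" for s
    using member_le_sum[of s S "\<lambda>s. \<bar>f s\<bar>"] that finite_gens by (simp add: K_def)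
  moreover have "K > 0" unfolding K_def by (smt (verit) sum_nonneg abs_ge_zero)
  ultimately show ?thesis using that subadditive_le_len[of f K] assms by blast
qed

lemma len_equivalent:
  assumes "generating_set G S'"
  obtains K where "K > 0" "\<And>g. g \<in> carrier G \<Longrightarrow> real (word_length G S' g) \<le> K * real (len g)"
proof -
  interpret S': generated_group G S' by unfold_locales fact
  show ?thesis
  proof (rule ex_subadditive_le_len[of "\<lambda>g. real (S'.len g)"])
    show "real (S'.len (g \<otimes> h)) \<le> real (S'.len g) + real (S'.len h)"
      if "g \<in> carrier G" "h \<in> carrier G" for g h
      using S'.len_mult[OF that] by linarith
  qed (use that in auto)
qed

end

section \<open>Extensions of free abelian groups\<close>

text \<open>The quotient map is recorded by its integer coordinates \<open>p i\<close> with
  \<open>i < r\<close>, so that computations in the quotient become integer arithmetic. The elements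
  \<open>a i\<close> lift the standard basis.\<close>

locale free_abelian_extension = generated_group G S for G (structure) and S +
  fixes p :: "nat \<Rightarrow> 'a \<Rightarrow> int" and r :: nat and a :: "nat \<Rightarrow> 'a" and N T :: "'a set"
  assumes p_mult: "i < r \<Longrightarrow> g \<in> carrier G \<Longrightarrow> h \<in> carrier G \<Longrightarrow> p i (g \<otimes> h) = p i g + p i h"
    and N_eq: "N = {g \<in> carrier G. \<forall>i<r. p i g = 0}"
    and a_closed: "i < r \<Longrightarrow> a i \<in> carrier G"
    and p_a: "i < r \<Longrightarrow> j < r \<Longrightarrow> p i (a j) = (if i = j then 1 else 0)"
    and N_generating: "generating_set (G\<lparr>carrier := N\<rparr>) T"
begin

abbreviation nlen :: "'a \<Rightarrow> nat" where "nlen g \<equiv> word_length (G\<lparr>carrier := N\<rparr>) T g"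

lemma p_one: "i < r \<Longrightarrow> p i \<one> = 0"
  using p_mult[of i \<one> \<one>] by simp

lemma p_inv: "i < r \<Longrightarrow> g \<in> carrier G \<Longrightarrow> p i (inv g) = - p i g"
  using p_mult[of i g "inv g"] p_one by simp

lemma p_nat_pow: "i < r \<Longrightarrow> g \<in> carrier G \<Longrightarrow> p i (g [^] (n::nat)) = int n * p i g"
  by (induction n) (simp_all add: p_one p_mult algebra_simps)

lemma p_int_pow: "i < r \<Longrightarrow> g \<in> carrier G \<Longrightarrow> p i (g [^] (k::int)) = k * p i g"
  by (cases "k < 0") (simp_all only: int_pow_def2 if_True if_False p_inv p_nat_pow nat_pow_closed, simp_all)

lemma N_closed: "h \<in> N \<Longrightarrow> h \<in> carrier G"
  by (simp add: N_eq)

lemma subgroup_N: "subgroup N G"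
  by unfold_locales (auto simp: N_eq p_mult p_one p_inv)

lemma N_mult: "g \<in> N \<Longrightarrow> h \<in> N \<Longrightarrow> g \<otimes> h \<in> N"
  using subgroup_N by (rule subgroup.m_closed)

lemma N_conj: "g \<in> carrier G \<Longrightarrow> h \<in> N \<Longrightarrow> g \<otimes> h \<otimes> inv g \<in> N"
  by (auto simp: N_eq p_mult p_inv)

lemma N_comm: "g \<in> carrier G \<Longrightarrow> h \<in> carrier G \<Longrightarrow> g \<otimes> h \<otimes> inv g \<otimes> inv h \<in> N"
  by (auto simp: N_eq p_mult p_inv)

text \<open>Multiplication, unit and carrier are rewritten, so that all facts about
  \<open>len\<close> become facts about \<open>nlen\<close> for products formed in
  \<open>G\<close>.\<close>

sublocale N: generated_group "G\<lparr>carrier := N\<rparr>" T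
  rewrites "monoid.mult (G\<lparr>carrier := N\<rparr>) = monoid.mult G"
    and "monoid.one (G\<lparr>carrier := N\<rparr>) = \<one>"
    and "partial_object.carrier (G\<lparr>carrier := N\<rparr>) = N"
  using subgroup.subgroup_is_group[OF subgroup_N group_axioms] N_generating
  by (auto simp: generated_group_def generated_group_axioms_def)

text \<open>Conjugation by a generator is an endomorphism of \<open>N\<close>, hence Lipschitz with
  a constant read off from the finitely many conjugates of letters in \<open>T\<close>. Conjugation
  by \<open>g\<close> composes \<open>len g\<close> such maps, whence the exponential
  factor.\<close>

lemma nlen_conj:
  obtains L :: nat where "L \<ge> 1"
    "\<And>g h. g \<in> carrier G \<Longrightarrow> h \<in> N \<Longrightarrow> nlen (g \<otimes> h \<otimes> inv g) \<le> L ^ len g * nlen h"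
proof -
  define L where "L = 1 + (\<Sum>s\<in>S. \<Sum>t\<in>T. nlen (s \<otimes> t \<otimes> inv s))"
  have L: "nlen (s \<otimes> h \<otimes> inv s) \<le> L * nlen h" if s: "s \<in> S" and h: "h \<in> N" for s h
  proof -
    have s': "s \<in> carrier G" using s gens_closed by blast
    have gens: "nlen (s \<otimes> t \<otimes> inv s) \<le> L" if t: "t \<in> T" for t
    proof -
      have "nlen (s \<otimes> t \<otimes> inv s) \<le> (\<Sum>t\<in>T. nlen (s \<otimes> t \<otimes> inv s))"
        using t N.finite_gens by (intro member_le_sum) auto
      also have "\<dots> \<le> (\<Sum>s\<in>S. \<Sum>t\<in>T. nlen (s \<otimes> t \<otimes> inv s))"
        using s finite_gens by (intro member_le_sum[of s S "\<lambda>s. \<Sum>t\<in>T. nlen (s \<otimes> t \<otimes> inv s)"]) auto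
      finally show ?thesis by (simp add: L_def)
    qed
    have "real (nlen (s \<otimes> h \<otimes> inv s)) \<le> real L * real (nlen h)"
    proof (rule N.subadditive_le_len[of "\<lambda>h. real (nlen (s \<otimes> h \<otimes> inv s))"])
      fix g h assume gh: "g \<in> N" "h \<in> N"
      have "s \<otimes> (g \<otimes> h) \<otimes> inv s = (s \<otimes> g \<otimes> inv s) \<otimes> (s \<otimes> h \<otimes> inv s)"
        using gh s' by (simp add: N_closed m_assoc inv_cancel_left)
      then have "nlen (s \<otimes> (g \<otimes> h) \<otimes> inv s) \<le> nlen (s \<otimes> g \<otimes> inv s) + nlen (s \<otimes> h \<otimes> inv s)"
        using N.len_mult[OF N_conj[OF s' gh(1)] N_conj[OF s' gh(2)]] by simp
      then show "real (nlen (s \<otimes> (g \<otimes> h) \<otimes> inv s))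
          \<le> real (nlen (s \<otimes> g \<otimes> inv s)) + real (nlen (s \<otimes> h \<otimes> inv s))" by linarith
    qed (use s' gens h in auto)
    then show ?thesis by (metis of_nat_le_iff of_nat_mult)
  qed
  have *: "nlen (word_prod G ws \<otimes> h \<otimes> inv (word_prod G ws)) \<le> L ^ length ws * nlen h"
    if "set ws \<subseteq> S" "h \<in> N" for ws h
    using that
  proof (induction ws)
    case (Cons s ws)
    let ?w = "word_prod G ws"
    have cl: "s \<in> carrier G" "?w \<in> carrier G" "set ws \<subseteq> carrier G"
      using Cons.prems gens_closed by auto
    have "s \<otimes> ?w \<otimes> h \<otimes> inv (s \<otimes> ?w) = s \<otimes> (?w \<otimes> h \<otimes> inv ?w) \<otimes> inv s"
      using cl Cons.prems by (simp add: N_closed m_assoc inv_mult_group)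
    then have "nlen (s \<otimes> ?w \<otimes> h \<otimes> inv (s \<otimes> ?w)) \<le> L * nlen (?w \<otimes> h \<otimes> inv ?w)"
      using L[of s "?w \<otimes> h \<otimes> inv ?w"] N_conj[OF cl(2) Cons.prems(2)] Cons.prems by simp
    also have "\<dots> \<le> L * (L ^ length ws * nlen h)"
      using Cons by (intro mult_le_mono2) auto
    finally show ?case by (simp add: mult.assoc)
  qed (simp add: N_closed)
  show ?thesis
  proof
    show "nlen (g \<otimes> h \<otimes> inv g) \<le> L ^ len g * nlen h" if "g \<in> carrier G" "h \<in> N" for g h
      using obtain_word[OF that(1)] *[OF _ that(2)] by metis
  qed (simp add: L_def)
qed

text \<open>Commutator expansion in both arguments, by induction on the word of \<open>h\<close>
  with a generator in the first place, and then on the word of \<open>g\<close>. Every pair of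
  letters contributes one commutator of generators, and every induction step costs one conjugation
  by a letter, that is, a factor \<open>L\<close>.\<close>

lemma nlen_comm:
  fixes L :: nat
  assumes "L \<ge> 1"
    and conj: "\<And>g h. g \<in> carrier G \<Longrightarrow> h \<in> N \<Longrightarrow> nlen (g \<otimes> h \<otimes> inv g) \<le> L ^ len g * nlen h"
  obtains C :: nat where
    "\<And>g h. g \<in> carrier G \<Longrightarrow> h \<in> carrier G \<Longrightarrow>
      nlen (g \<otimes> h \<otimes> inv g \<otimes> inv h) \<le> C * (len g * len h) * L ^ (len g + len h)"
proof -
  define C where "C = (\<Sum>s\<in>S. \<Sum>t\<in>S. nlen (s \<otimes> t \<otimes> inv s \<otimes> inv t))"
  have C: "nlen (s \<otimes> t \<otimes> inv s \<otimes> inv t) \<le> C" if "s \<in> S" "t \<in> S" for s t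
  proof -
    have "nlen (s \<otimes> t \<otimes> inv s \<otimes> inv t) \<le> (\<Sum>t\<in>S. nlen (s \<otimes> t \<otimes> inv s \<otimes> inv t))"
      using that finite_gens by (intro member_le_sum) auto
    also have "\<dots> \<le> C" unfolding C_def
      using that finite_gens
      by (intro member_le_sum[of s S "\<lambda>s. \<Sum>t\<in>S. nlen (s \<otimes> t \<otimes> inv s \<otimes> inv t)"]) auto
    finally show ?thesis .
  qed
  have conj_gen: "nlen (s \<otimes> h \<otimes> inv s) \<le> L * nlen h" if "s \<in> S" "h \<in> N" for s h
  proof -
    have "nlen (s \<otimes> h \<otimes> inv s) \<le> L ^ len s * nlen h"
      using that gens_closed by (intro conj) auto
    also have "\<dots> \<le> L ^ 1 * nlen h"
      using len_gen[OF that(1)] \<open>L \<ge> 1\<close> by (intro mult_le_mono1 power_increasing) auto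
    finally show ?thesis by simp
  qed
  have gen_word: "nlen (s \<otimes> word_prod G ws \<otimes> inv s \<otimes> inv (word_prod G ws))
      \<le> C * length ws * L ^ length ws" if "s \<in> S" "set ws \<subseteq> S" for s ws
    using that(2)
  proof (induction ws)
    case Nil
    then show ?case using that gens_closed by auto
  next
    case (Cons t ws)
    let ?w = "word_prod G ws"
    let ?c = "s \<otimes> ?w \<otimes> inv s \<otimes> inv ?w"
    have cl: "s \<in> carrier G" "t \<in> carrier G" "?w \<in> carrier G" "t \<in> S"
      using Cons.prems gens_closed that by auto
    \<comment> \<open>The identity [s, t w] = [s, t] (t [s, w] t^-1), where [x, y] = x y x^-1
      y^-1.\<close>
    have "s \<otimes> (t \<otimes> ?w) \<otimes> inv s \<otimes> inv (t \<otimes> ?w)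
        = (s \<otimes> t \<otimes> inv s \<otimes> inv t) \<otimes> (t \<otimes> ?c \<otimes> inv t)"
      using cl by (simp add: m_assoc inv_mult_group inv_cancel_left)
    then have "nlen (s \<otimes> (t \<otimes> ?w) \<otimes> inv s \<otimes> inv (t \<otimes> ?w))
        \<le> nlen (s \<otimes> t \<otimes> inv s \<otimes> inv t) + nlen (t \<otimes> ?c \<otimes> inv t)"
      using N.len_mult[OF N_comm[OF cl(1,2)] N_conj[OF cl(2) N_comm[OF cl(1,3)]]] by simp
    also have "\<dots> \<le> C + L * (C * length ws * L ^ length ws)"
      using C[OF that(1) cl(4)] conj_gen[OF cl(4) N_comm[OF cl(1,3)]] Cons
      by (intro add_mono order.trans[OF conj_gen[OF cl(4) N_comm[OF cl(1,3)]]] mult_le_mono2) auto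
    also have "\<dots> \<le> C * L ^ Suc (length ws) + L * (C * length ws * L ^ length ws)"
      using \<open>L \<ge> 1\<close> one_le_power[of L "Suc (length ws)"] by (intro add_mono) auto
    also have "\<dots> = C * length (t # ws) * L ^ length (t # ws)"
      by (simp add: algebra_simps)
    finally show ?case by simp
  qed
  have gen: "nlen (s \<otimes> h \<otimes> inv s \<otimes> inv h) \<le> C * len h * L ^ len h"
    if "s \<in> S" "h \<in> carrier G" for s h
    using obtain_word[OF that(2)] gen_word[OF that(1)] by metis
  have word: "nlen (word_prod G ws \<otimes> h \<otimes> inv (word_prod G ws) \<otimes> inv h)
      \<le> C * (length ws * len h) * L ^ (length ws + len h)"
    if "h \<in> carrier G" "set ws \<subseteq> S" for h ws
    using that(2)
  proof (induction ws)
    case Nil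
    then show ?case using that by auto
  next
    case (Cons s ws)
    let ?w = "word_prod G ws"
    let ?c = "?w \<otimes> h \<otimes> inv ?w \<otimes> inv h"
    have cl: "s \<in> carrier G" "h \<in> carrier G" "?w \<in> carrier G" "s \<in> S"
      using Cons.prems gens_closed that by auto
    \<comment> \<open>The identity [s w, h] = (s [w, h] s^-1) [s, h].\<close>
    have "(s \<otimes> ?w) \<otimes> h \<otimes> inv (s \<otimes> ?w) \<otimes> inv h
        = (s \<otimes> ?c \<otimes> inv s) \<otimes> (s \<otimes> h \<otimes> inv s \<otimes> inv h)"
      using cl by (simp add: m_assoc inv_mult_group inv_cancel_left)
    then have "nlen ((s \<otimes> ?w) \<otimes> h \<otimes> inv (s \<otimes> ?w) \<otimes> inv h)
        \<le> nlen (s \<otimes> ?c \<otimes> inv s) + nlen (s \<otimes> h \<otimes> inv s \<otimes> inv h)"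
      using N.len_mult[OF N_conj[OF cl(1) N_comm[OF cl(3,2)]] N_comm[OF cl(1,2)]] by simp
    also have "\<dots> \<le> L * (C * (length ws * len h) * L ^ (length ws + len h)) + C * len h * L ^ len h"
      using Cons cl gen
      by (intro add_mono order.trans[OF conj_gen[OF cl(4) N_comm[OF cl(3,2)]]] mult_le_mono2) auto
    also have "\<dots> \<le> L * (C * (length ws * len h) * L ^ (length ws + len h))
        + C * len h * L ^ (Suc (length ws) + len h)"
      using \<open>L \<ge> 1\<close> by (intro add_mono mult_le_mono2 power_increasing) auto
    also have "\<dots> = C * (length (s # ws) * len h) * L ^ (length (s # ws) + len h)"
      by (simp add: algebra_simps)
    finally show ?case by simp
  qed
  show ?thesis
  proof
    show "nlen (g \<otimes> h \<otimes> inv g \<otimes> inv h) \<le> C * (len g * len h) * L ^ (len g + len h)"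
      if "g \<in> carrier G" "h \<in> carrier G" for g h
      using obtain_word[OF that(1)] word[OF that(2)] by metis
  qed
qed

section \<open>A section of the quotient map and the \<open>N\<close>-length of its defect\<close>

primrec tau :: "nat \<Rightarrow> (nat \<Rightarrow> int) \<Rightarrow> 'a" where
  "tau 0 v = \<one>"
| "tau (Suc k) v = tau k v \<otimes> a k [^] v k"

lemma tau_closed: "k \<le> r \<Longrightarrow> tau k v \<in> carrier G"
  by (induction k) (auto simp: a_closed)

lemma p_tau: "k \<le> r \<Longrightarrow> i < r \<Longrightarrow> p i (tau k v) = (if i < k then v i else 0)"
proof (induction k)
  case (Suc k)
  then show ?case
    using p_mult[of i "tau k v" "a k [^] v k"] tau_closed[of k v] a_closed[of k]
    by (auto simp: p_int_pow p_a less_Suc_eq)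
qed (simp add: p_one)

lemma len_a_pow:
  assumes "\<And>j. j < r \<Longrightarrow> len (a j) \<le> A" "k < r" "\<bar>z\<bar> \<le> int R"
  shows "len (a k [^] (z::int)) \<le> A * R"
proof -
  have "len (a k [^] z) \<le> nat \<bar>z\<bar> * len (a k)"
    using a_closed assms by (intro len_int_pow) auto
  also have "\<dots> \<le> R * A"
    using assms by (intro mult_le_mono) auto
  finally show ?thesis by (simp add: mult.commute)
qed

lemma len_tau:
  assumes "\<And>j. j < r \<Longrightarrow> len (a j) \<le> A" "\<And>j. j < r \<Longrightarrow> \<bar>v j\<bar> \<le> int R"
  shows "k \<le> r \<Longrightarrow> len (tau k v) \<le> k * (A * R)"
proof (induction k)
  case (Suc k)
  have "len (tau (Suc k) v) \<le> len (tau k v) + len (a k [^] v k)"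
    using Suc a_closed[of k] tau_closed[of k v] len_mult by simp
  also have "\<dots> \<le> k * (A * R) + A * R"
    using Suc len_a_pow[of A k "v k" R] assms by (intro add_mono) auto
  finally show ?case by simp
qed simp

text \<open>\<open>tau\<close> fails to be additive because the lifts \<open>a j\<close> need not
  commute. At stage \<open>k\<close> the power \<open>a k [^] v k\<close> has to move past
  \<open>tau k u\<close>, which creates a single commutator, conjugated by \<open>tau k v\<close>.
  Both arguments and the conjugator have length at most \<open>m\<close>, whence the exponent
  \<open>3 * m\<close>.\<close>

lemma nlen_tau_cocycle:
  fixes L C m :: nat
  assumes "L \<ge> 1"
    and conj: "\<And>g h. g \<in> carrier G \<Longrightarrow> h \<in> N \<Longrightarrow> nlen (g \<otimes> h \<otimes> inv g) \<le> L ^ len g * nlen h"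
    and comm: "\<And>g h. g \<in> carrier G \<Longrightarrow> h \<in> carrier G \<Longrightarrow>
      nlen (g \<otimes> h \<otimes> inv g \<otimes> inv h) \<le> C * (len g * len h) * L ^ (len g + len h)"
    and v: "\<And>k. k \<le> r \<Longrightarrow> len (tau k v) \<le> m" "\<And>k. k < r \<Longrightarrow> len (a k [^] v k) \<le> m"
    and u: "\<And>k. k \<le> r \<Longrightarrow> len (tau k u) \<le> m"
  shows "k \<le> r \<Longrightarrow> tau k v \<otimes> tau k u \<otimes> inv (tau k (\<lambda>j. v j + u j)) \<in> N \<and>
    nlen (tau k v \<otimes> tau k u \<otimes> inv (tau k (\<lambda>j. v j + u j))) \<le> k * (C * (m * m) * L ^ (3 * m))"
proof (induction k)
  case 0
  then show ?case using subgroup.one_closed[OF subgroup_N] by simp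
next
  case (Suc k)
  let ?v = "tau k v" and ?u = "tau k u" and ?w = "tau k (\<lambda>j. v j + u j)"
  let ?b = "a k [^] v k" and ?c = "a k [^] u k"
  have cl: "?v \<in> carrier G" "?u \<in> carrier G" "?w \<in> carrier G" "?b \<in> carrier G" "?c \<in> carrier G" "a k \<in> carrier G"
    using Suc.prems by (auto simp: tau_closed a_closed)
  have pow: "a k [^] (v k + u k) = ?b \<otimes> ?c"
    by (rule int_pow_mult) (fact cl)
  \<comment> \<open>Here \<open>?c\<close> cancels against its inverse, and
    \<open>?b \<otimes> ?u\<close> is the commutator times \<open>?u \<otimes> ?b\<close>.\<close>
  have eq: "tau (Suc k) v \<otimes> tau (Suc k) u \<otimes> inv (tau (Suc k) (\<lambda>j. v j + u j))
      = (?v \<otimes> (?b \<otimes> ?u \<otimes> inv ?b \<otimes> inv ?u) \<otimes> inv ?v) \<otimes> (?v \<otimes> ?u \<otimes> inv ?w)"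
    using cl by (simp add: pow m_assoc inv_mult_group inv_cancel_left)
  have IH: "?v \<otimes> ?u \<otimes> inv ?w \<in> N"
    "nlen (?v \<otimes> ?u \<otimes> inv ?w) \<le> k * (C * (m * m) * L ^ (3 * m))"
    using Suc by auto
  have first: "?v \<otimes> (?b \<otimes> ?u \<otimes> inv ?b \<otimes> inv ?u) \<otimes> inv ?v \<in> N"
    using cl by (intro N_conj N_comm)
  have lens: "len ?v \<le> m" "len ?u \<le> m" "len ?b \<le> m"
    using v u Suc.prems by auto
  have "nlen (?v \<otimes> (?b \<otimes> ?u \<otimes> inv ?b \<otimes> inv ?u) \<otimes> inv ?v)
      \<le> L ^ len ?v * nlen (?b \<otimes> ?u \<otimes> inv ?b \<otimes> inv ?u)"
    using cl by (intro conj N_comm)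
  also have "\<dots> \<le> L ^ m * (C * (len ?b * len ?u) * L ^ (len ?b + len ?u))"
    using \<open>L \<ge> 1\<close> lens by (intro mult_le_mono power_increasing comm cl) auto
  also have "\<dots> \<le> L ^ m * (C * (m * m) * L ^ (m + m))"
    using \<open>L \<ge> 1\<close> lens by (intro mult_le_mono power_increasing add_mono order_refl) auto
  also have "\<dots> = C * (m * m) * L ^ (3 * m)"
  proof -
    have "3 * m = m + (m + m)" by simp
    then show ?thesis by (simp only: power_add) (simp add: algebra_simps)
  qed
  finally have "nlen (?v \<otimes> (?b \<otimes> ?u \<otimes> inv ?b \<otimes> inv ?u) \<otimes> inv ?v) \<le> C * (m * m) * L ^ (3 * m)" .
  then show ?case
    using eq N_mult[OF first IH(1)] N.len_mult[OF first IH(1)] IH(2) by simp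
qed

lemma tau_cong: "(\<And>j. j < k \<Longrightarrow> v j = u j) \<Longrightarrow> tau k v = tau k u"
  by (induction k) simp_all

text \<open>Split off from \<open>s\<close> the section of its own coordinates; the remaining factor
  \<open>rest s\<close> lies in \<open>N\<close>. The correction is then the conjugate of
  \<open>rest s\<close> by \<open>tau r v\<close> times the defect of \<open>tau\<close>. Finiteness
  of \<open>U\<close> makes the constants uniform.\<close>

lemma nlen_tau_step:
  assumes U: "finite U" "U \<subseteq> carrier G"
  obtains K E :: nat where "K \<ge> 1" "E \<ge> 1"
    "\<And>R v s. s \<in> U \<Longrightarrow> (\<And>j. j < r \<Longrightarrow> \<bar>v j\<bar> \<le> int R) \<Longrightarrow>
      tau r v \<otimes> s \<otimes> inv (tau r (\<lambda>j. v j + p j s)) \<in> N \<and>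
      nlen (tau r v \<otimes> s \<otimes> inv (tau r (\<lambda>j. v j + p j s))) \<le> K * E ^ R"
proof -
  obtain L :: nat where L: "L \<ge> 1"
    "\<And>g h. g \<in> carrier G \<Longrightarrow> h \<in> N \<Longrightarrow> nlen (g \<otimes> h \<otimes> inv g) \<le> L ^ len g * nlen h"
    using nlen_conj by blast
  obtain C :: nat where C: "\<And>g h. g \<in> carrier G \<Longrightarrow> h \<in> carrier G \<Longrightarrow>
      nlen (g \<otimes> h \<otimes> inv g \<otimes> inv h) \<le> C * (len g * len h) * L ^ (len g + len h)"
    using nlen_comm[OF L] by blast
  define A where "A = (\<Sum>j<r. len (a j))"
  have A: "len (a j) \<le> A" if "j < r" for j
    using that unfolding A_def by (intro member_le_sum) auto
  define B where "B = nat (\<Sum>s\<in>U. \<Sum>j<r. \<bar>p j s\<bar>)"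
  have B: "\<bar>p j s\<bar> \<le> int B" if "s \<in> U" "j < r" for j s
  proof -
    have "\<bar>p j s\<bar> \<le> (\<Sum>j<r. \<bar>p j s\<bar>)"
      using that by (intro member_le_sum) auto
    also have "\<dots> \<le> (\<Sum>s\<in>U. \<Sum>j<r. \<bar>p j s\<bar>)"
      using that U by (intro member_le_sum[of s U "\<lambda>s. \<Sum>j<r. \<bar>p j s\<bar>"]) (auto intro: sum_nonneg)
    finally show ?thesis by (simp add: B_def sum_nonneg)
  qed
  define rest where "rest s = s \<otimes> inv (tau r (\<lambda>j. p j s))" for s
  have rest: "rest s \<in> N" if "s \<in> U" for s
    using that U by (auto simp: rest_def N_eq p_mult p_inv tau_closed p_tau)
  define K0 where "K0 = (\<Sum>s\<in>U. nlen (rest s))"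
  have K0: "nlen (rest s) \<le> K0" if "s \<in> U" for s
    using that U unfolding K0_def by (intro member_le_sum) auto
  \<comment> \<open>\<open>L ^ 3\<close> matches the exponent \<open>3 * m\<close> of the defect,
    and 4 absorbs the polynomial factor through m * m <= 4^m. The factor \<open>q\<close> turns a
    bound on coordinates into one on the lengths of all \<open>tau k v\<close> and of all powers
    \<open>a k [^] v k\<close>.\<close>
  define E0 K q where "E0 = 4 * L ^ 3" and "K = (1 + K0 + r * C)" and "q = (r + 1) * A"
  have "E0 \<ge> 1" using L(1) by (simp add: E0_def)
  have main: "tau r v \<otimes> s \<otimes> inv (tau r (\<lambda>j. v j + p j s)) \<in> N \<and>
      nlen (tau r v \<otimes> s \<otimes> inv (tau r (\<lambda>j. v j + p j s))) \<le> K * E0 ^ (q * (R + B))"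
    if s: "s \<in> U" and v: "\<And>j. j < r \<Longrightarrow> \<bar>v j\<bar> \<le> int R" for R v s
  proof -
    define m where "m = q * (R + B)"
    let ?u = "\<lambda>j. p j s"
    let ?w = "tau r (\<lambda>j. v j + p j s)"
    let ?z = "tau r v \<otimes> tau r ?u \<otimes> inv ?w"
    have cl: "s \<in> carrier G" "tau r v \<in> carrier G" "tau r ?u \<in> carrier G" "?w \<in> carrier G"
      using s U by (auto simp: tau_closed)
    have v': "\<bar>v j\<bar> \<le> int (R + B)" if "j < r" for j using v[OF that] by simp
    have u': "\<bar>p j s\<bar> \<le> int (R + B)" if "j < r" for j using B[OF s that] by simp
    have km: "k * (A * (R + B)) \<le> m" if "k \<le> r + 1" for k
      using that unfolding m_def q_def by (simp only: mult.assoc) (rule mult_le_mono1)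
    have tv: "len (tau k v) \<le> m" if "k \<le> r" for k
      using len_tau[of A v "R + B", OF A v' that] km[of k] that by simp
    have tu: "len (tau k ?u) \<le> m" if "k \<le> r" for k
      using len_tau[of A ?u "R + B", OF A u' that] km[of k] that by simp
    have av: "len (a k [^] v k) \<le> m" if "k < r" for k
      using len_a_pow[OF A that v'[OF that]] km[of 1] by simp
    have z: "?z \<in> N" "nlen ?z \<le> r * (C * (m * m) * L ^ (3 * m))"
      using nlen_tau_cocycle[of L C v m ?u r, OF L C tv av tu] by simp_all
    have rs: "tau r v \<otimes> rest s \<otimes> inv (tau r v) \<in> N"
      using cl rest[OF s] by (intro N_conj)
    have eq: "tau r v \<otimes> s \<otimes> inv ?w = (tau r v \<otimes> rest s \<otimes> inv (tau r v)) \<otimes> ?z"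
      using cl by (simp add: rest_def m_assoc inv_cancel_left)
    have "nlen (tau r v \<otimes> rest s \<otimes> inv (tau r v)) \<le> L ^ len (tau r v) * nlen (rest s)"
      using cl rest[OF s] by (intro L(2))
    also have "\<dots> \<le> L ^ (3 * m) * K0"
      using L(1) tv[of r] K0[OF s] by (intro mult_le_mono power_increasing) auto
    also have "\<dots> \<le> E0 ^ m * K0"
      by (intro mult_le_mono1) (simp add: E0_def power_mult power_mult_distrib)
    finally have 1: "nlen (tau r v \<otimes> rest s \<otimes> inv (tau r v)) \<le> E0 ^ m * K0" .
    have "m * m \<le> 2 ^ m * 2 ^ m"
      by (intro mult_le_mono) (simp_all add: less_imp_le)
    also have "\<dots> = (4::nat) ^ m" by (simp flip: power_mult_distrib)
    finally have "C * (m * m) * L ^ (3 * m) \<le> C * 4 ^ m * L ^ (3 * m)"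
      by (intro mult_le_mono1 mult_le_mono2)
    also have "\<dots> = C * E0 ^ m"
      by (simp add: E0_def power_mult power_mult_distrib)
    finally have "nlen ?z \<le> r * (C * E0 ^ m)"
      using z(2) by (meson le_trans mult_le_mono2)
    then have "nlen (tau r v \<otimes> s \<otimes> inv ?w) \<le> E0 ^ m * K0 + r * (C * E0 ^ m)"
      using N.len_mult[OF rs z(1)] 1 eq by simp
    also have "\<dots> \<le> K * E0 ^ m" by (simp add: K_def algebra_simps)
    finally show ?thesis using eq N_mult[OF rs z(1)] by (simp add: m_def)
  qed
  show ?thesis
  proof
    show "K * E0 ^ (q * B) \<ge> 1" "E0 ^ q \<ge> 1" using \<open>E0 \<ge> 1\<close> one_le_power[of E0] by (auto simp: K_def intro: trans_le_add1)
    \<comment> \<open>The step bound \<open>B\<close> is fixed by \<open>U\<close>, so its share of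
      the exponent moves into the constant.\<close>
    have *: "K * E0 ^ (q * B) * (E0 ^ q) ^ R = K * E0 ^ (q * (R + B))" for R
      by (simp add: distrib_left power_add ac_simps flip: power_mult)
    show "tau r v \<otimes> s \<otimes> inv (tau r (\<lambda>j. v j + p j s)) \<in> N \<and>
      nlen (tau r v \<otimes> s \<otimes> inv (tau r (\<lambda>j. v j + p j s))) \<le> K * E0 ^ (q * B) * (E0 ^ q) ^ R"
      if "s \<in> U" "\<And>j. j < r \<Longrightarrow> \<bar>v j\<bar> \<le> int R" for R v s
      using main[OF that] unfolding * .
  qed
qed

text \<open>The estimate is deterministic and holds for every word over \<open>U\<close>. This
  finite set is kept apart from \<open>S\<close>: it becomes the support of the step law, while the
  distortion is measured with respect to \<open>S\<close>.\<close>

lemma len_word_prod_le: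
  assumes U: "finite U" "U \<subseteq> carrier G"
    and dist: "c > 0" "\<And>h. h \<in> N \<Longrightarrow> real (len h) \<le> c * ln (real (nlen h) + 1) + c"
  obtains C where "C > 0"
    "\<And>ws R. set ws \<subseteq> U \<Longrightarrow>
      (\<And>k j. k \<le> length ws \<Longrightarrow> j < r \<Longrightarrow> \<bar>p j (word_prod G (take k ws))\<bar> \<le> int R) \<Longrightarrow>
      real (len (word_prod G ws)) \<le> C * (real R + ln (real (length ws) + 1) + 1)"
proof -
  obtain K E :: nat where KE: "K \<ge> 1" "E \<ge> 1" and step:
    "\<And>R v s. s \<in> U \<Longrightarrow> (\<And>j. j < r \<Longrightarrow> \<bar>v j\<bar> \<le> int R) \<Longrightarrow>
      tau r v \<otimes> s \<otimes> inv (tau r (\<lambda>j. v j + p j s)) \<in> N \<and>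
      nlen (tau r v \<otimes> s \<otimes> inv (tau r (\<lambda>j. v j + p j s))) \<le> K * E ^ R"
  proof (rule nlen_tau_step[OF U], goal_cases)
    case (1 K E)
    show ?case by (rule 1(1)[OF 1(2,3)]) (rule 1(4), assumption, blast)
  qed
  define A where "A = (\<Sum>j<r. len (a j))"
  have A: "len (a j) \<le> A" if "j < r" for j
    using that unfolding A_def by (intro member_le_sum) auto
  let ?t = "\<lambda>g. tau r (\<lambda>j. p j g)"
  have N_part: "word_prod G ws \<otimes> inv (?t (word_prod G ws)) \<in> N \<and>
      nlen (word_prod G ws \<otimes> inv (?t (word_prod G ws))) \<le> length ws * (K * E ^ R)"
    if "set ws \<subseteq> U" "\<And>k j. k \<le> length ws \<Longrightarrow> j < r \<Longrightarrow> \<bar>p j (word_prod G (take k ws))\<bar> \<le> int R"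
    for ws R
    using that
  proof (induction ws rule: rev_induct)
    case Nil
    have "?t \<one> = tau r (\<lambda>_. 0)" by (rule tau_cong) (simp add: p_one)
    also have "\<dots> = \<one>"
    proof -
      have "tau k (\<lambda>_. 0) = \<one>" if "k \<le> r" for k using that by (induction k) (auto simp: a_closed)
      then show ?thesis by simp
    qed
    finally show ?case using subgroup.one_closed[OF subgroup_N] by simp
  next
    case (snoc s ws)
    let ?g = "word_prod G ws"
    have cl: "s \<in> carrier G" "set ws \<subseteq> carrier G" "?g \<in> carrier G" "s \<in> U"
      using snoc.prems U by auto
    have app: "word_prod G (ws @ [s]) = ?g \<otimes> s"
      using cl by (simp add: word_prod_append)
    have *: "\<bar>p j (word_prod G (take k ws))\<bar> \<le> int R" if "k \<le> length ws" "j < r" for k j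
      using snoc.prems(2)[of k j] that by simp
    let ?D = "?t ?g \<otimes> s \<otimes> inv (tau r (\<lambda>j. p j ?g + p j s))"
    have t: "?t (?g \<otimes> s) = tau r (\<lambda>j. p j ?g + p j s)"
      by (rule tau_cong) (simp add: p_mult cl)
    have IH: "?g \<otimes> inv (?t ?g) \<in> N" "nlen (?g \<otimes> inv (?t ?g)) \<le> length ws * (K * E ^ R)"
      using snoc.IH snoc.prems(1) * by auto
    have D: "?D \<in> N" "nlen ?D \<le> K * E ^ R"
      using step[of s "\<lambda>j. p j ?g" R, OF cl(4)] *[of "length ws"] by auto
    \<comment> \<open>Telescoping: \<open>inv (?t ?g)\<close> cancels the first factor of
      \<open>?D\<close>.\<close>
    have eq: "?g \<otimes> s \<otimes> inv (?t (?g \<otimes> s)) = (?g \<otimes> inv (?t ?g)) \<otimes> ?D"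
      unfolding t using cl by (simp add: m_assoc inv_cancel_left tau_closed)
    show ?case unfolding app eq
      using N_mult[OF IH(1) D(1)] N.len_mult[OF IH(1) D(1)] IH(2) D(2) by simp
  qed
  define C where "C = c + c * ln K + c * ln E + r * A + c"
  have nn: "0 \<le> c * ln K" "0 \<le> c * ln E" using KE dist by auto
  show ?thesis
  proof
    show "C > 0" using nn dist(1) by (simp add: C_def add_pos_nonneg)
    fix ws R
    assume ws: "set ws \<subseteq> U"
      "\<And>k j. k \<le> length ws \<Longrightarrow> j < r \<Longrightarrow> \<bar>p j (word_prod G (take k ws))\<bar> \<le> int R"
    let ?g = "word_prod G ws"
    let ?h = "?g \<otimes> inv (?t ?g)"
    let ?n = "length ws"
    have g: "?g \<in> carrier G" "?t ?g \<in> carrier G" using ws U by (auto simp: tau_closed)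
    have h: "?h \<in> N" "nlen ?h \<le> ?n * (K * E ^ R)" using N_part[OF ws] by auto
    have "real (len ?h) \<le> c * ln (real (nlen ?h) + 1) + c"
      using dist h by blast
    also have "\<dots> \<le> c * ln ((real ?n + 1) * (real K * real E ^ R)) + c"
    proof -
      \<comment> \<open>Since \<open>K * E ^ R\<close> is at least 1, the 1 inside the logarithm is
        absorbed by replacing the number of letters \<open>?n\<close> by \<open>?n + 1\<close>; this
        is one reason to keep \<open>K\<close> and \<open>E\<close> at least 1.\<close>
      have "nlen ?h + 1 \<le> (?n + 1) * (K * E ^ R)"
      proof -
        have "1 * 1 \<le> K * E ^ R" using KE by (intro mult_le_mono one_le_power)
        then have "nlen ?h + 1 \<le> ?n * (K * E ^ R) + K * E ^ R"
          by (intro add_mono h(2)) (simp only: mult_1)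
        then show ?thesis by (simp only: distrib_right mult_1)
      qed
      then have "real (nlen ?h + 1) \<le> real ((?n + 1) * (K * E ^ R))"
        by (simp only: of_nat_le_iff)
      then have "ln (real (nlen ?h) + 1) \<le> ln ((real ?n + 1) * (real K * real E ^ R))"
        by (intro ln_mono) (auto simp: algebra_simps)
      then show ?thesis using dist(1) by simp
    qed
    also have "\<dots> = c * ln (real ?n + 1) + c * ln K + c * (R * ln E) + c"
    proof -
      have "ln ((real ?n + 1) * (real K * real E ^ R)) = ln (real ?n + 1) + (ln K + R * ln E)"
        using KE by (subst ln_mult, simp, simp)+ (simp add: ln_realpow)
      then show ?thesis by (simp only: distrib_left add.assoc)
    qed
    finally have 1: "real (len ?h) \<le> c * ln (real ?n + 1) + c * ln K + c * (R * ln E) + c" .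
    have "len (?t ?g) \<le> r * (A * R)"
      using ws(2)[of ?n] by (intro len_tau A) auto
    then have 2: "real (len (?t ?g)) \<le> r * A * R"
      by (metis of_nat_le_iff of_nat_mult mult.assoc)
    have "?g = ?h \<otimes> ?t ?g" using g by (simp add: m_assoc)
    then have "len ?g \<le> len ?h + len (?t ?g)"
      using len_mult[OF N_closed[OF h(1)] g(2)] by simp
    then have "real (len ?g) \<le> real (len ?h) + real (len (?t ?g))" by linarith
    also have "\<dots> \<le> c * ln (real ?n + 1) + c * ln K + R * (c * ln E) + c + R * (r * A)"
      using 1 2 by (simp add: algebra_simps)
    also have "\<dots> \<le> C * ln (real ?n + 1) + C + C * R"
    proof -
      have C: "c \<le> C" "c * ln K + c \<le> C" "c * ln E + r * A \<le> C"
        using nn dist(1) by (simp_all add: C_def)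
      have "c * ln (real ?n + 1) \<le> C * ln (real ?n + 1)" "(c * ln E + r * A) * R \<le> C * R"
        using C by (intro mult_right_mono; simp)+
      with C(2) show ?thesis by (simp add: algebra_simps)
    qed
    finally show "real (len ?g) \<le> C * (real R + ln (real ?n + 1) + 1)"
      by (simp add: algebra_simps)
  qed
qed

end

section \<open>Symmetric walks on the line\<close>

lemma expectation_bind_finite:
  fixes h :: "'b \<Rightarrow> real"
  assumes "finite (set_pmf p)" "\<And>x. x \<in> set_pmf p \<Longrightarrow> finite (set_pmf (f x))"
  shows "measure_pmf.expectation (p \<bind> f) h =
    measure_pmf.expectation p (\<lambda>x. measure_pmf.expectation (f x) h)"
  using assms by (simp add: pmf_expectation_bind[of "set_pmf p"] integral_measure_pmf[of "set_pmf p"])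

lemma finite_set_replicate_pmf:
  assumes "finite (set_pmf p)"
  shows "finite (set_pmf (replicate_pmf n p))"
proof (rule finite_subset[OF _ finite_lists_length_eq[OF assms, of n]])
  show "set_pmf (replicate_pmf n p) \<subseteq> {xs. set xs \<subseteq> set_pmf p \<and> length xs = n}"
    by (auto simp: set_replicate_pmf)
qed

lemma map_replicate_pmf: "map_pmf (map f) (replicate_pmf n p) = replicate_pmf n (map_pmf f p)"
proof (induction n)
  case (Suc n)
  have "map_pmf (map f) (replicate_pmf (Suc n) p) =
      map_pmf f p \<bind> (\<lambda>y. map_pmf (map f) (replicate_pmf n p) \<bind> (\<lambda>ys. return_pmf (y # ys)))"
    by (simp add: map_bind_pmf bind_map_pmf)
  then show ?case by (simp add: Suc)
qed simp

lemma prob_eq_expectation: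
  "measure_pmf.prob p {x. P x} = measure_pmf.expectation p (\<lambda>x. of_bool (P x))"
proof -
  have "(\<lambda>x. of_bool (P x)) = (indicator {x. P x} :: _ \<Rightarrow> real)" by (auto simp: indicator_def)
  then show ?thesis by simp
qed

text \<open>Conditioning on the first \<open>m\<close> letters. Together with the version for the
  first letter below, it carries the arguments by independence within a finite product.\<close>

lemma expectation_replicate_append:
  fixes h :: "'a list \<Rightarrow> real"
  assumes "finite (set_pmf p)"
  shows "measure_pmf.expectation (replicate_pmf (m + n) p) h =
    measure_pmf.expectation (replicate_pmf m p)
      (\<lambda>xs. measure_pmf.expectation (replicate_pmf n p) (\<lambda>ys. h (xs @ ys)))"
  unfolding replicate_pmf_distrib
  using finite_set_replicate_pmf[OF assms]
  by (subst expectation_bind_finite) (auto simp: map_pmf_def[symmetric])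

lemma expectation_replicate_Suc:
  fixes h :: "'a list \<Rightarrow> real"
  assumes "finite (set_pmf p)"
  shows "measure_pmf.expectation (replicate_pmf (Suc n) p) h =
    measure_pmf.expectation p
      (\<lambda>x. measure_pmf.expectation (replicate_pmf n p) (\<lambda>xs. h (x # xs)))"
  unfolding replicate_pmf.simps
  using finite_set_replicate_pmf[OF assms] assms
  by (subst expectation_bind_finite) (auto simp: map_pmf_def[symmetric])

lemmas prob_replicate_append =
  expectation_replicate_append[of _ _ _ "\<lambda>xs. of_bool (P xs)" for P, folded prob_eq_expectation]

lemmas prob_replicate_Suc =
  expectation_replicate_Suc[of _ _ "\<lambda>xs. of_bool (P xs)" for P, folded prob_eq_expectation]

lemma expectation_mono_finite:
  fixes f g :: "'a \<Rightarrow> real"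
  assumes "finite (set_pmf p)" "\<And>x. x \<in> set_pmf p \<Longrightarrow> f x \<le> g x"
  shows "measure_pmf.expectation p f \<le> measure_pmf.expectation p g"
  using assms by (intro integral_mono_AE integrable_measure_pmf_finite) (auto simp: AE_measure_pmf_iff)

text \<open>The step law of one coordinate. Symmetry makes odd moments vanish and exchanges the two
  tails. \<open>B\<close> is positive even if the law is concentrated at 0, so that it may appear in
  denominators.\<close>

locale centred_step =
  fixes \<nu> :: "real pmf" and B :: real
  assumes finite_support: "finite (set_pmf \<nu>)"
    and bounded: "x \<in> set_pmf \<nu> \<Longrightarrow> \<bar>x\<bar> \<le> B"
    and symmetric: "map_pmf uminus \<nu> = \<nu>"
    and B_pos: "B > 0"
begin

abbreviation steps :: "nat \<Rightarrow> real list pmf" where "steps n \<equiv> replicate_pmf n \<nu>"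

lemma integrable_step [simp]: "integrable (measure_pmf \<nu>) (f :: real \<Rightarrow> real)"
  by (rule integrable_measure_pmf_finite[OF finite_support])

lemma integrable_steps [simp]: "integrable (measure_pmf (steps n)) (f :: real list \<Rightarrow> real)"
  by (rule integrable_measure_pmf_finite[OF finite_set_replicate_pmf[OF finite_support]])

lemma symmetric_steps: "map_pmf (map uminus) (steps n) = steps n"
  by (simp add: map_replicate_pmf symmetric)

lemma sum_list_uminus: "sum_list (map uminus xs) = - sum_list (xs :: real list)"
  by (induction xs) auto

lemma prob_uminus:
  "measure_pmf.prob (steps n) {xs. P (map uminus xs)} = measure_pmf.prob (steps n) {xs. P xs}"
  by (subst (2) symmetric_steps[symmetric]) (simp add: vimage_def)

lemma expectation_odd:
  assumes "\<And>x. f (- x) = - (f x :: real)"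
  shows "measure_pmf.expectation \<nu> f = 0"
proof -
  have "measure_pmf.expectation \<nu> f = measure_pmf.expectation \<nu> (\<lambda>x. f (- x))"
    by (subst symmetric[symmetric]) simp
  then show ?thesis by (simp add: assms)
qed

section \<open>Exponential moments and the maximal inequality\<close>

lemma mgf_ge_1: "measure_pmf.expectation \<nu> (\<lambda>x. exp (l * x)) \<ge> 1"
proof -
  have "measure_pmf.expectation \<nu> (\<lambda>x. 1 + l * x) \<le> measure_pmf.expectation \<nu> (\<lambda>x. exp (l * x))"
    by (intro expectation_mono_finite finite_support exp_ge_add_one_self)
  then show ?thesis by (simp add: expectation_odd)
qed

lemma mgf_le:
  assumes "l > 0"
  shows "measure_pmf.expectation \<nu> (\<lambda>x. exp (l * x)) \<le> exp (l\<^sup>2 * B\<^sup>2 / 2)"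
proof -
  interpret interval_bounded_random_variable "measure_pmf \<nu>" "\<lambda>x. x" "- B" B
    by unfold_locales (auto simp: AE_measure_pmf_iff dest!: bounded)
  have "ennreal (measure_pmf.expectation \<nu> (\<lambda>x. exp (l * x))) = nn_integral \<nu> (\<lambda>x. exp (l * x))"
    by (rule nn_integral_eq_integral[symmetric]) auto
  also have "\<dots> \<le> ennreal (exp (l\<^sup>2 * (B - - B)\<^sup>2 / 8))"
    by (rule Hoeffdings_lemma_nn_integral_0) (simp_all add: assms expectation_odd)
  also have "l\<^sup>2 * (B - - B)\<^sup>2 / 8 = l\<^sup>2 * B\<^sup>2 / 2"
    by (simp add: power2_eq_square field_simps)
  finally show ?thesis by (simp add: ennreal_le_iff)
qed

text \<open>A maximal inequality of Doob type for the exponential of the partial sums, by recursion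
  on the first step: after a step x the remaining walk must reach \<open>a - x\<close>. The maximum
  costs nothing compared with the end point, because the moment generating function is at least
  1.\<close>

lemma prob_max_ge_mgf:
  assumes "l \<ge> 0"
  shows "measure_pmf.prob (steps n) {xs. \<exists>k\<le>n. a \<le> sum_list (take k xs)}
    \<le> exp (- l * a) * measure_pmf.expectation \<nu> (\<lambda>x. exp (l * x)) ^ n"
proof (induction n arbitrary: a)
  case 0
  show ?case
  proof (cases "a \<le> 0")
    case True
    then show ?thesis using assms by (simp add: mult_nonneg_nonpos)
  next
    case False
    then show ?thesis by (simp add: prob_eq_expectation)
  qed
next
  case (Suc n)
  let ?m = "measure_pmf.expectation \<nu> (\<lambda>x. exp (l * x))"
  show ?case
  proof (cases "a \<le> 0")
    case True
    have "1 * 1 \<le> exp (- l * a) * ?m ^ Suc n"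
      using True assms mgf_ge_1 by (intro mult_mono one_le_power) (auto simp: mult_nonneg_nonpos)
    then show ?thesis by (intro order.trans[OF measure_pmf.prob_le_1]) simp
  next
    case False
    have "measure_pmf.prob (steps (Suc n)) {xs. \<exists>k\<le>Suc n. a \<le> sum_list (take k xs)}
        = measure_pmf.expectation \<nu> (\<lambda>x. measure_pmf.prob (steps n) {xs. \<exists>k\<le>Suc n. a \<le> sum_list (take k (x # xs))})"
      by (rule prob_replicate_Suc[OF finite_support])
    also have "\<dots> \<le> measure_pmf.expectation \<nu> (\<lambda>x. exp (- l * (a - x)) * ?m ^ n)"
    proof (intro expectation_mono_finite finite_support)
      fix x
      have "measure_pmf.prob (steps n) {xs. \<exists>k\<le>Suc n. a \<le> sum_list (take k (x # xs))}
          \<le> measure_pmf.prob (steps n) {xs. \<exists>k\<le>n. a - x \<le> sum_list (take k xs)}"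
      proof (intro measure_pmf.finite_measure_mono subsetI CollectI)
        fix xs assume "xs \<in> {xs. \<exists>k\<le>Suc n. a \<le> sum_list (take k (x # xs))}"
        then obtain k where k: "k \<le> Suc n" "a \<le> sum_list (take k (x # xs))" by blast
        \<comment> \<open>As \<open>a\<close> is positive, the level is not reached at
          \<open>k = 0\<close>, so the index can be lowered by one.\<close>
        with False show "\<exists>k\<le>n. a - x \<le> sum_list (take k xs)"
          by (cases k) (auto intro!: exI[of _ "k - 1"])
      qed simp
      also have "\<dots> \<le> exp (- l * (a - x)) * ?m ^ n" by (rule Suc.IH)
      finally show "measure_pmf.prob (steps n) {xs. \<exists>k\<le>Suc n. a \<le> sum_list (take k (x # xs))}
          \<le> exp (- l * (a - x)) * ?m ^ n" .
    qed
    also have "\<dots> = measure_pmf.expectation \<nu> (\<lambda>x. (exp (- l * a) * ?m ^ n) * exp (l * x))"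
      by (intro Bochner_Integration.integral_cong refl)
         (simp add: right_diff_distrib exp_diff exp_minus field_simps flip: exp_add)
    also have "\<dots> = exp (- l * a) * ?m ^ Suc n" by simp
    finally show ?thesis .
  qed
qed

lemma prob_max_ge:
  assumes "a \<ge> 0" "n \<ge> 1"
  shows "measure_pmf.prob (steps n) {xs. \<exists>k\<le>n. a \<le> sum_list (take k xs)}
    \<le> exp (- (a\<^sup>2 / (2 * real n * B\<^sup>2)))"
proof (cases "a = 0")
  case False
  \<comment> \<open>The minimiser of the exponent - l a + n l^2 B^2 / 2.\<close>
  define l where "l = a / (n * B\<^sup>2)"
  have l: "l > 0" using False assms B_pos by (simp add: l_def)
  have "measure_pmf.prob (steps n) {xs. \<exists>k\<le>n. a \<le> sum_list (take k xs)}
      \<le> exp (- l * a) * measure_pmf.expectation \<nu> (\<lambda>x. exp (l * x)) ^ n"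
    using l by (intro prob_max_ge_mgf) simp
  also have "\<dots> \<le> exp (- l * a) * exp (l\<^sup>2 * B\<^sup>2 / 2) ^ n"
    using mgf_le[OF l] mgf_ge_1[of l] by (intro mult_left_mono power_mono) auto
  also have "\<dots> = exp (- (a\<^sup>2 / (2 * real n * B\<^sup>2)))"
    using assms B_pos unfolding l_def
    by (simp flip: exp_of_nat_mult exp_add) (simp add: field_simps power2_eq_square)
  finally show ?thesis .
qed simp

lemma prob_max_abs_ge:
  assumes "a \<ge> 0" "n \<ge> 1"
  shows "measure_pmf.prob (steps n) {xs. \<exists>k\<le>n. a \<le> \<bar>sum_list (take k xs)\<bar>}
    \<le> 2 * exp (- (a\<^sup>2 / (2 * real n * B\<^sup>2)))"
proof -
  let ?P = "\<lambda>xs. \<exists>k\<le>n. a \<le> sum_list (take k xs)"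
  have "measure_pmf.prob (steps n) {xs. \<exists>k\<le>n. a \<le> \<bar>sum_list (take k xs)\<bar>}
      \<le> measure_pmf.prob (steps n) ({xs. ?P xs} \<union> {xs. ?P (map uminus xs)})"
    by (intro measure_pmf.finite_measure_mono)
       (auto simp: take_map sum_list_uminus abs_real_def split: if_splits)
  also have "\<dots> \<le> measure_pmf.prob (steps n) {xs. ?P xs} + measure_pmf.prob (steps n) {xs. ?P (map uminus xs)}"
    by (rule measure_Un_le) auto
  also have "\<dots> \<le> 2 * exp (- (a\<^sup>2 / (2 * real n * B\<^sup>2)))"
    using prob_max_ge[OF assms] by (subst prob_uminus) simp
  finally show ?thesis .
qed

section \<open>Second and fourth moments of the sum\<close>

lemma expectation_odd_steps:
  assumes "\<And>x. f (- x) = - (f x :: real)"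
  shows "measure_pmf.expectation (steps n) (\<lambda>xs. f (sum_list xs)) = 0"
proof -
  have "measure_pmf.expectation (steps n) (\<lambda>xs. f (sum_list xs))
      = measure_pmf.expectation (steps n) (\<lambda>xs. f (sum_list (map uminus xs)))"
    by (subst symmetric_steps[symmetric]) simp
  then show ?thesis by (simp add: sum_list_uminus assms)
qed

definition step_variance :: real where "step_variance = measure_pmf.expectation \<nu> (\<lambda>x. x\<^sup>2)"

lemma step_variance_nonneg: "step_variance \<ge> 0"
  by (simp add: step_variance_def)

lemma step_variance_le: "step_variance \<le> B\<^sup>2"
proof -
  have "step_variance \<le> measure_pmf.expectation \<nu> (\<lambda>_. B\<^sup>2)"
    unfolding step_variance_def using bounded B_pos
    by (intro expectation_mono_finite finite_support) (force intro: abs_le_square_iff[THEN iffD1])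
  then show ?thesis by simp
qed

lemma second_moment: "measure_pmf.expectation (steps n) (\<lambda>xs. (sum_list xs)\<^sup>2) = n * step_variance"
proof (induction n)
  case (Suc n)
  have "measure_pmf.expectation (steps n) (\<lambda>xs. (sum_list (x # xs))\<^sup>2) = x\<^sup>2 + n * step_variance" for x
    using expectation_odd_steps[of "\<lambda>x. x" n] by (simp add: power2_sum Suc)
  then show ?case
    by (simp add: expectation_replicate_Suc[OF finite_support] step_variance_def algebra_simps del: replicate_pmf.simps)
qed simp

text \<open>Only the even terms of the binomial expansion survive, and the induction closes because
  1 + 6 n + 3 n^2 <= 3 (n + 1)^2. The order n^2 of the squared second moment is what the escape
  estimate below requires.\<close>

lemma fourth_moment: "measure_pmf.expectation (steps n) (\<lambda>xs. (sum_list xs) ^ 4) \<le> 3 * (real n)\<^sup>2 * B ^ 4"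
proof (induction n)
  case (Suc n)
  let ?M = "measure_pmf.expectation (steps n) (\<lambda>xs. (sum_list xs) ^ 4)"
  have "measure_pmf.expectation (steps n) (\<lambda>xs. (sum_list (x # xs)) ^ 4)
      = x ^ 4 + 6 * (n * step_variance) * x\<^sup>2 + ?M" for x
  proof -
    have "(sum_list (x # xs)) ^ 4 = x ^ 4 + 4 * x ^ 3 * sum_list xs + 6 * x\<^sup>2 * (sum_list xs)\<^sup>2
        + 4 * x * (sum_list xs) ^ 3 + (sum_list xs) ^ 4" for xs
      by (simp add: algebra_simps power2_eq_square power3_eq_cube power4_eq_xxxx)
    then show ?thesis
      using expectation_odd_steps[of "\<lambda>x. x" n] expectation_odd_steps[of "\<lambda>x. x ^ 3" n]
      by (simp add: second_moment)
  qed
  then have "measure_pmf.expectation (steps (Suc n)) (\<lambda>xs. (sum_list xs) ^ 4)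
      = measure_pmf.expectation \<nu> (\<lambda>x. x ^ 4) + 6 * (n * step_variance) * step_variance + ?M"
    by (simp add: expectation_replicate_Suc[OF finite_support] step_variance_def del: replicate_pmf.simps)
  also have "\<dots> \<le> B ^ 4 + 6 * (n * B\<^sup>2) * B\<^sup>2 + 3 * (real n)\<^sup>2 * B ^ 4"
  proof (intro add_mono Suc.IH mult_mono mult_left_mono step_variance_le)
    have "measure_pmf.expectation \<nu> (\<lambda>x. x ^ 4) \<le> measure_pmf.expectation \<nu> (\<lambda>_. B ^ 4)"
    proof (intro expectation_mono_finite finite_support)
      fix x assume "x \<in> set_pmf \<nu>"
      then have "\<bar>x\<bar> ^ 4 \<le> B ^ 4" using bounded by (intro power_mono) auto
      then show "x ^ 4 \<le> B ^ 4" by simp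
    qed
    then show "measure_pmf.expectation \<nu> (\<lambda>x. x ^ 4) \<le> B ^ 4" by simp
  qed (auto simp: step_variance_nonneg)
  also have "\<dots> \<le> 3 * (real (Suc n))\<^sup>2 * B ^ 4"
    using B_pos by (simp add: algebra_simps power2_eq_square power4_eq_xxxx)
  finally show ?case .
qed simp

text \<open>Independence of consecutive blocks. Iterated, it gives explicit lower bounds for
  displacements far above the typical order, the input for the lower half of the iterated
  logarithm.\<close>

lemma prob_sum_add_ge:
  "measure_pmf.prob (steps m) {xs. a \<le> sum_list xs} * measure_pmf.prob (steps n) {xs. b \<le> sum_list xs}
    \<le> measure_pmf.prob (steps (m + n)) {xs. a + b \<le> sum_list xs}"
proof -
  let ?q = "measure_pmf.prob (steps n) {ys. b \<le> sum_list ys}"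
  have "measure_pmf.prob (steps m) {xs. a \<le> sum_list xs} * ?q
      = measure_pmf.expectation (steps m) (\<lambda>xs. of_bool (a \<le> sum_list xs) * ?q)"
    by (simp add: prob_eq_expectation)
  also have "\<dots> \<le> measure_pmf.expectation (steps m)
      (\<lambda>xs. measure_pmf.prob (steps n) {ys. a + b \<le> sum_list (xs @ ys)})"
  proof (intro expectation_mono_finite finite_set_replicate_pmf finite_support)
    fix xs
    show "of_bool (a \<le> sum_list xs) * ?q \<le> measure_pmf.prob (steps n) {ys. a + b \<le> sum_list (xs @ ys)}"
      by (cases "a \<le> sum_list xs") (auto intro!: measure_pmf.finite_measure_mono)
  qed
  also have "\<dots> = measure_pmf.prob (steps (m + n)) {zs. a + b \<le> sum_list zs}"
    by (rule prob_replicate_append[OF finite_support, symmetric])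
  finally show ?thesis .
qed

lemma prob_sum_mult_ge:
  "measure_pmf.prob (steps m) {xs. a \<le> sum_list xs} ^ k
    \<le> measure_pmf.prob (steps (k * m)) {xs. real k * a \<le> sum_list xs}"
proof (induction k)
  case (Suc k)
  have "measure_pmf.prob (steps m) {xs. a \<le> sum_list xs} ^ Suc k
      \<le> measure_pmf.prob (steps m) {xs. a \<le> sum_list xs}
        * measure_pmf.prob (steps (k * m)) {xs. real k * a \<le> sum_list xs}"
    using Suc by (simp add: mult_left_mono)
  also have "\<dots> \<le> measure_pmf.prob (steps (m + k * m)) {xs. a + real k * a \<le> sum_list xs}"
    by (rule prob_sum_add_ge)
  finally show ?case by (simp add: algebra_simps)
qed simp

lemma prob_sum_half:
  assumes "a \<ge> 0"
  shows "measure_pmf.prob (steps n) {xs. a < \<bar>sum_list xs\<bar>} \<le> 2 * measure_pmf.prob (steps n) {xs. a < sum_list xs}"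
proof -
  have "measure_pmf.prob (steps n) {xs. a < \<bar>sum_list xs\<bar>}
      \<le> measure_pmf.prob (steps n) ({xs. a < sum_list xs} \<union> {xs. a < sum_list (map uminus xs)})"
    by (intro measure_pmf.finite_measure_mono) (auto simp: sum_list_uminus abs_real_def split: if_splits)
  also have "\<dots> \<le> measure_pmf.prob (steps n) {xs. a < sum_list xs}
      + measure_pmf.prob (steps n) {xs. a < sum_list (map uminus xs)}"
    by (rule measure_Un_le) auto
  finally show ?thesis by (simp add: prob_uminus[of n "\<lambda>xs. a < sum_list xs"])
qed

lemma prob_sum_nonneg: "measure_pmf.prob (steps n) {xs. 0 \<le> sum_list xs} \<ge> 1 / 2"
proof -
  have "1 = measure_pmf.prob (steps n) ({xs. 0 \<le> sum_list xs} \<union> {xs. 0 \<le> sum_list (map uminus xs)})"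
    by (subst measure_pmf.prob_eq_1[THEN iffD2]) (auto simp: sum_list_uminus)
  also have "\<dots> \<le> measure_pmf.prob (steps n) {xs. 0 \<le> sum_list xs}
      + measure_pmf.prob (steps n) {xs. 0 \<le> sum_list (map uminus xs)}"
    by (rule measure_Un_le) auto
  finally show ?thesis by (simp add: prob_uminus[of n "\<lambda>xs. 0 \<le> sum_list xs"])
qed

end

locale nondegenerate_step = centred_step +
  assumes nondegenerate: "\<exists>x\<in>set_pmf \<nu>. x \<noteq> 0"
begin

lemma step_variance_pos: "step_variance > 0"
proof -
  have "step_variance \<noteq> 0"
  proof
    assume "step_variance = 0"
    then have "AE x in \<nu>. x\<^sup>2 = 0"
      unfolding step_variance_def by (subst (asm) integral_nonneg_eq_0_iff_AE) auto
    with nondegenerate show False by (auto simp: AE_measure_pmf_iff)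
  qed
  then show ?thesis using step_variance_nonneg by simp
qed

text \<open>With m = n * \<open>step_variance\<close> for the second moment and Q = 3 n^2 B^4 for
  the bound on the fourth, these are the values for which sqrt (m / 2) = \<open>esc_rate\<close> *
  sqrt n and m^2 / (4 Q) = \<open>esc_prob\<close>; both are independent of n.\<close>

definition esc_rate :: real where "esc_rate = sqrt (step_variance / 2)"
definition esc_prob :: real where "esc_prob = step_variance\<^sup>2 / (12 * B ^ 4)"

lemma esc_rate_pos: "esc_rate > 0" and esc_prob_pos: "esc_prob > 0"
  using step_variance_pos B_pos by (simp_all add: esc_rate_def esc_prob_def)

text \<open>The Paley--Zygmund inequality, from \<open>1 \<ge> 2 s y - (s y)\<^sup>2\<close> with \<open>y = S\<^sub>n\<^sup>2 - n step_variance / 2\<close>: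
  the right-hand side is nonpositive where \<open>y \<le> 0\<close>.\<close>

lemma prob_abs_sum_gt:
  assumes "n \<ge> 1"
  shows "measure_pmf.prob (steps n) {xs. esc_rate * sqrt n < \<bar>sum_list xs\<bar>} \<ge> esc_prob"
proof -
  define m where "m = n * step_variance"
  define Q where "Q = 3 * (real n)\<^sup>2 * B ^ 4"
  \<comment> \<open>The maximiser of s m - s^2 Q, whose maximum m^2 / (4 Q) is
    \<open>esc_prob\<close>.\<close>
  define s where "s = m / (2 * Q)"
  have pos: "m > 0" "Q > 0" "s > 0"
    using assms step_variance_pos B_pos by (simp_all add: m_def Q_def s_def)
  let ?E = "measure_pmf.expectation (steps n)"
  let ?S = "sum_list :: real list \<Rightarrow> real"
  have gt: "esc_rate * sqrt n < \<bar>?S xs\<bar> \<longleftrightarrow> m / 2 < (?S xs)\<^sup>2" for xs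
  proof -
    have "esc_rate * sqrt n = sqrt (m / 2)"
      by (simp add: esc_rate_def m_def real_sqrt_mult[symmetric] mult.commute)
    moreover have "sqrt (m / 2) < \<bar>?S xs\<bar> \<longleftrightarrow> sqrt (m / 2) < sqrt ((?S xs)\<^sup>2)" by simp
    ultimately show ?thesis by (simp only: real_sqrt_less_iff)
  qed
  have "?E (\<lambda>xs. 2 * s * ((?S xs)\<^sup>2 - m / 2) - s\<^sup>2 * ((?S xs)\<^sup>2 - m / 2)\<^sup>2) \<le> ?E (\<lambda>xs. of_bool (m / 2 < (?S xs)\<^sup>2))"
  proof (intro expectation_mono_finite finite_set_replicate_pmf finite_support)
    fix xs
    let ?y = "(?S xs)\<^sup>2 - m / 2"
    have "(1 - s * ?y)\<^sup>2 \<ge> 0" by simp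
    then have "2 * s * ?y - s\<^sup>2 * ?y\<^sup>2 \<le> 1" by (simp add: power2_eq_square algebra_simps)
    moreover have "2 * s * ?y - s\<^sup>2 * ?y\<^sup>2 \<le> 0" if "?y \<le> 0"
    proof -
      have "2 * s * ?y \<le> 0" using that pos by (intro mult_nonneg_nonpos) auto
      moreover have "s\<^sup>2 * ?y\<^sup>2 \<ge> 0" by simp
      ultimately show ?thesis by linarith
    qed
    ultimately show "2 * s * ?y - s\<^sup>2 * ?y\<^sup>2 \<le> of_bool (m / 2 < (?S xs)\<^sup>2)" by (cases "?y \<le> 0") auto
  qed
  moreover have "?E (\<lambda>xs. 2 * s * ((?S xs)\<^sup>2 - m / 2) - s\<^sup>2 * ((?S xs)\<^sup>2 - m / 2)\<^sup>2)
      = s * m - s\<^sup>2 * ?E (\<lambda>xs. ((?S xs)\<^sup>2 - m / 2)\<^sup>2)"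
    by (simp add: second_moment m_def)
  moreover have "?E (\<lambda>xs. ((?S xs)\<^sup>2 - m / 2)\<^sup>2) \<le> Q"
  proof -
    have "((?S xs)\<^sup>2 - m / 2)\<^sup>2 = (?S xs) ^ 4 - m * (?S xs)\<^sup>2 + m\<^sup>2 / 4" for xs
      by (simp add: power2_eq_square power4_eq_xxxx field_simps)
    then have "?E (\<lambda>xs. ((?S xs)\<^sup>2 - m / 2)\<^sup>2) = ?E (\<lambda>xs. (?S xs) ^ 4) - m * m + m\<^sup>2 / 4"
      by (simp add: second_moment m_def)
    also have "\<dots> \<le> Q" using fourth_moment[of n] mult_pos_pos[OF pos(1,1)] by (simp add: Q_def power2_eq_square)
    finally show ?thesis .
  qed
  then have "s\<^sup>2 * ?E (\<lambda>xs. ((?S xs)\<^sup>2 - m / 2)\<^sup>2) \<le> s\<^sup>2 * Q" by (intro mult_left_mono) auto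
  moreover have "s * m - s\<^sup>2 * Q = esc_prob"
    using pos assms B_pos by (simp add: s_def) (simp add: m_def Q_def esc_prob_def field_simps power2_eq_square power4_eq_xxxx)
  ultimately show ?thesis by (simp add: gt prob_eq_expectation)
qed

text \<open>Concatenating \<open>k\<close> blocks of length \<open>n div k\<close> that each gain \<open>esc_rate \<cdot> sqrt (n div k)\<close>.\<close>

lemma prob_sum_ge_blocks:
  assumes "1 \<le> k" "k \<le> n"
  shows "measure_pmf.prob (steps n) {xs. esc_rate * sqrt (real n * real k / 2) \<le> sum_list xs}
    \<ge> (esc_prob / 2) ^ k / 2"
proof -
  define m where "m = n div k"
  have m: "m \<ge> 1" using assms by (simp add: m_def div_greater_zero_iff Suc_le_eq)
  have n: "n = k * m + n mod k" by (simp add: m_def)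
  have "n mod k < k" "k \<le> k * m" using assms m by auto
  \<comment> \<open>The remainder is smaller than \<open>k * m\<close>, so rounding \<open>n\<close>
    down to a multiple of \<open>k\<close> costs at most a factor 2, the one under the root.\<close>
  then have "n \<le> 2 * (k * m)" using n by linarith
  then have "real n \<le> real (2 * (k * m))" by (simp only: of_nat_le_iff)
  then have "real n * real k / 2 \<le> (real k)\<^sup>2 * real m"
    using mult_right_mono[of "real n" "real (2 * (k * m))" "real k"] by (simp add: power2_eq_square algebra_simps)
  then have "sqrt (real n * real k / 2) \<le> sqrt ((real k)\<^sup>2 * real m)" by simp
  also have "\<dots> = real k * sqrt m" by (simp add: real_sqrt_mult)
  finally have le: "esc_rate * sqrt (real n * real k / 2) \<le> real k * (esc_rate * sqrt m)"
    using mult_left_mono[of _ _ esc_rate] esc_rate_pos by (simp add: algebra_simps)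
  have "esc_prob / 2 \<le> measure_pmf.prob (steps m) {xs. esc_rate * sqrt m < sum_list xs}"
    using prob_abs_sum_gt[OF m] prob_sum_half[of "esc_rate * sqrt m" m] esc_rate_pos by simp
  also have "\<dots> \<le> measure_pmf.prob (steps m) {xs. esc_rate * sqrt m \<le> sum_list xs}"
    by (intro measure_pmf.finite_measure_mono) auto
  finally have "(esc_prob / 2) ^ k \<le> measure_pmf.prob (steps m) {xs. esc_rate * sqrt m \<le> sum_list xs} ^ k"
    using esc_prob_pos by (intro power_mono) auto
  also note prob_sum_mult_ge
  \<comment> \<open>The \<open>n mod k\<close> steps left over only need a nonnegative sum, which
    accounts for the last factor 1/2.\<close>
  finally have "(esc_prob / 2) ^ k * (1 / 2) \<le> measure_pmf.prob (steps (k * m)) {xs. real k * (esc_rate * sqrt m) \<le> sum_list xs}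
      * measure_pmf.prob (steps (n mod k)) {xs. 0 \<le> sum_list xs}"
    using prob_sum_nonneg by (intro mult_mono) auto
  also note prob_sum_add_ge
  also have "measure_pmf.prob (steps (k * m + n mod k)) {xs. real k * (esc_rate * sqrt m) + 0 \<le> sum_list xs}
      \<le> measure_pmf.prob (steps n) {xs. esc_rate * sqrt (real n * real k / 2) \<le> sum_list xs}"
    unfolding n[symmetric] using le by (intro measure_pmf.finite_measure_mono) auto
  finally show ?thesis by simp
qed

end

section \<open>Independent identically distributed sequences\<close>

lemma pmf_replicate_pmf:
  assumes "finite (set_pmf p)"
  shows "pmf (replicate_pmf (length xs) p) xs = prod_list (map (pmf p) xs)"
proof (induction xs)
  case (Cons y ys)
  have "measure_pmf.prob (replicate_pmf (length ys) p) {zs. x # zs = y # ys}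
      = pmf (replicate_pmf (length ys) p) ys * indicator {y} x" for x
    by (cases "x = y") (simp_all add: measure_pmf_single)
  then have "measure_pmf.prob (replicate_pmf (Suc (length ys)) p) {zs. zs = y # ys}
      = pmf p y * pmf (replicate_pmf (length ys) p) ys"
    by (subst prob_replicate_Suc[OF assms]) (simp only:, simp add: measure_pmf_single)
  then show ?case using Cons by (simp add: measure_pmf_single del: replicate_pmf.simps)
qed simp

text \<open>Encoded by arbitrary predicates on finite prefixes: no sigma-algebra on the values has
  to be carried along, every image sequence is covered at once, and laws are those of
  \<open>replicate_pmf\<close>.\<close>

locale iid_sequence = prob_space M for M :: "'w measure" +
  fixes Y :: "nat \<Rightarrow> 'w \<Rightarrow> 'b" and \<nu> :: "'b pmf"
  assumes prefix_events: "{\<omega> \<in> space M. P (map (\<lambda>i. Y i \<omega>) [1..<Suc n])} \<in> events"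
    and prefix_law: "prob {\<omega> \<in> space M. P (map (\<lambda>i. Y i \<omega>) [1..<Suc n])}
      = measure_pmf.prob (replicate_pmf n \<nu>) {xs. P xs}"

lemma (in iid_sequence) iid_map:
  fixes f :: "'b \<Rightarrow> 'c"
  shows "iid_sequence M (\<lambda>i \<omega>. f (Y i \<omega>)) (map_pmf f \<nu>)"
proof (intro iid_sequence.intro iid_sequence_axioms.intro prob_space_axioms)
  fix P :: "'c list \<Rightarrow> bool" and n
  have eq: "map (\<lambda>i. f (Y i \<omega>)) [1..<Suc n] = map f (map (\<lambda>i. Y i \<omega>) [1..<Suc n])" for \<omega>
    by simp
  show "{\<omega> \<in> space M. P (map (\<lambda>i. f (Y i \<omega>)) [1..<Suc n])} \<in> events"
    unfolding eq by (rule prefix_events)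
  show "prob {\<omega> \<in> space M. P (map (\<lambda>i. f (Y i \<omega>)) [1..<Suc n])}
      = measure_pmf.prob (replicate_pmf n (map_pmf f \<nu>)) {xs. P xs}"
    unfolding eq prefix_law[of "\<lambda>xs. P (map f xs)"] by (simp add: map_replicate_pmf[symmetric] vimage_def)
qed

text \<open>Over a countable alphabet there are only countably many prefixes, so every event is a
  countable union of measurable atoms. Independence gives the law of an atom as a product, and the
  finite support reduces all other events to finitely many atoms.\<close>

lemma (in prob_space) iid_sequenceI:
  assumes indep: "indep_vars (\<lambda>_. count_space A) \<xi> {1..}"
    and law: "\<And>i x. i \<ge> 1 \<Longrightarrow> x \<in> A \<Longrightarrow> prob {\<omega> \<in> space M. \<xi> i \<omega> = x} = pmf \<mu> x"
    and "countable A" "finite (set_pmf \<mu>)" "set_pmf \<mu> \<subseteq> A"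
  shows "iid_sequence M \<xi> \<mu>"
proof (intro iid_sequence.intro iid_sequence_axioms.intro prob_space_axioms)
  fix P :: "'b list \<Rightarrow> bool" and n
  note [simp del] = upt_Suc
  let ?l = "\<lambda>\<omega>. map (\<lambda>i. \<xi> i \<omega>) [1..<Suc n]"
  let ?L = "{xs. set xs \<subseteq> A \<and> length xs = n}"
  have rv: "random_variable (count_space A) (\<xi> i)" if "i \<ge> 1" for i
    using indep that by (auto simp: indep_vars_def)
  have in_L: "?l \<omega> \<in> ?L" if "\<omega> \<in> space M" for \<omega>
    using measurable_space[OF rv that] by auto
  have eq_nth: "?l \<omega> = xs \<longleftrightarrow> (\<forall>i\<in>{1..n}. \<xi> i \<omega> = xs ! (i - 1))" if "length xs = n" for xs \<omega>
  proof
    assume "?l \<omega> = xs"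
    then show "\<forall>i\<in>{1..n}. \<xi> i \<omega> = xs ! (i - 1)"
      by auto
  next
    assume "\<forall>i\<in>{1..n}. \<xi> i \<omega> = xs ! (i - 1)"
    then show "?l \<omega> = xs"
      using that by (intro nth_equalityI) auto
  qed
  have ev: "{\<omega> \<in> space M. \<xi> i \<omega> = x} \<in> events" if "i \<ge> 1" "x \<in> A" for i x
    using measurable_sets[OF rv[OF that(1)], of "{x}"] that by (simp add: vimage_def Collect_conj_eq Int_commute)
  have point_ev: "{\<omega> \<in> space M. ?l \<omega> = xs} \<in> events" if "xs \<in> ?L" for xs
  proof -
    have "{\<omega> \<in> space M. \<forall>i\<in>{1..n}. \<xi> i \<omega> = xs ! (i - 1)} \<in> events"
      using that by (intro sets.sets_Collect_finite_All ev) (auto intro!: subsetD[OF _ nth_mem])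
    then show ?thesis using eq_nth that by simp
  qed
  have point_law: "prob {\<omega> \<in> space M. ?l \<omega> = xs} = pmf (replicate_pmf n \<mu>) xs" if "xs \<in> ?L" for xs
  proof (cases "n = 0")
    \<comment> \<open>Independence speaks about nonempty index sets only, so the empty prefix is
      treated apart.\<close>
    case True
    then show ?thesis using that by (simp add: prob_space)
  next
    case False
    have mem: "xs ! (i - 1) \<in> A" if "i \<in> {1..n}" for i
      using that \<open>xs \<in> ?L\<close> by (auto intro!: subsetD[OF _ nth_mem])
    have "{\<omega> \<in> space M. ?l \<omega> = xs} = (\<Inter>i\<in>{1..n}. \<xi> i -` {xs ! (i - 1)} \<inter> space M)"
      using eq_nth that False by auto
    also have "prob \<dots> = (\<Prod>i\<in>{1..n}. prob (\<xi> i -` {xs ! (i - 1)} \<inter> space M))"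
      using False mem by (intro indep_varsD[OF indep]) auto
    also have "\<dots> = (\<Prod>i\<in>{1..n}. pmf \<mu> (xs ! (i - 1)))"
      using law mem by (intro prod.cong refl) (simp add: vimage_def Collect_conj_eq Int_commute)
    also have "\<dots> = (\<Prod>i\<in>{0..<n}. pmf \<mu> (xs ! i))"
      by (rule prod.reindex_bij_witness[of _ Suc "\<lambda>i. i - 1"]) auto
    also have "\<dots> = prod_list (map (pmf \<mu>) xs)"
      using that by (simp add: prod.list_conv_set_nth)
    also have "\<dots> = pmf (replicate_pmf n \<mu>) xs"
      using that pmf_replicate_pmf[OF assms(4), of xs] by simp
    finally show ?thesis .
  qed
  have "countable ?L"
    by (rule countable_subset[OF _ countable_lists[OF \<open>countable A\<close>]]) auto
  have events: "{\<omega> \<in> space M. Q (?l \<omega>)} \<in> events" for Q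
  proof -
    have "{\<omega> \<in> space M. Q (?l \<omega>)} = (\<Union>xs\<in>{xs \<in> ?L. Q xs}. {\<omega> \<in> space M. ?l \<omega> = xs})"
      using in_L by auto
    also have "\<dots> \<in> events"
      using point_ev
      by (intro sets.countable_UN'' countable_subset[OF _ \<open>countable ?L\<close>]) auto
    finally show ?thesis .
  qed
  \<comment> \<open>One inequality suffices: applied to an event and to its complement it forces
    equality, since both laws have total mass 1.\<close>
  have ge: "measure_pmf.prob (replicate_pmf n \<mu>) {xs. Q xs} \<le> prob {\<omega> \<in> space M. Q (?l \<omega>)}" for Q
  proof -
    let ?F = "{xs \<in> set_pmf (replicate_pmf n \<mu>). Q xs}"
    have F: "finite ?F" "?F \<subseteq> ?L"
      using assms(5)
      by (auto intro: finite_subset[OF _ finite_set_replicate_pmf[OF assms(4), of n]] simp: set_replicate_pmf)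
    have "measure_pmf.prob (replicate_pmf n \<mu>) {xs. Q xs} = measure_pmf.prob (replicate_pmf n \<mu>) ?F"
      by (intro measure_pmf.finite_measure_eq_AE) (auto simp: AE_measure_pmf_iff)
    also have "\<dots> = (\<Sum>xs\<in>?F. prob {\<omega> \<in> space M. ?l \<omega> = xs})"
      using F point_law by (subst measure_measure_pmf_finite) (auto intro!: sum.cong)
    also have "\<dots> = prob (\<Union>xs\<in>?F. {\<omega> \<in> space M. ?l \<omega> = xs})"
      using F point_ev by (intro finite_measure_finite_Union[symmetric]) (auto simp: disjoint_family_on_def)
    also have "\<dots> \<le> prob {\<omega> \<in> space M. Q (?l \<omega>)}"
      by (intro finite_measure_mono events) auto
    finally show ?thesis .
  qed
  show "{\<omega> \<in> space M. P (?l \<omega>)} \<in> events" by (rule events)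
  have "prob {\<omega> \<in> space M. \<not> P (?l \<omega>)} = 1 - prob {\<omega> \<in> space M. P (?l \<omega>)}"
    by (rule prob_neg) (rule events)
  moreover have "measure_pmf.prob (replicate_pmf n \<mu>) {xs. \<not> P xs}
      = 1 - measure_pmf.prob (replicate_pmf n \<mu>) {xs. P xs}"
    using measure_pmf.prob_neg[of "replicate_pmf n \<mu>" P] by simp
  ultimately show "prob {\<omega> \<in> space M. P (?l \<omega>)} = measure_pmf.prob (replicate_pmf n \<mu>) {xs. P xs}"
    using ge[of P] ge[of "\<lambda>xs. \<not> P xs"] by linarith
qed

context iid_sequence
begin

text \<open>The second Borel--Cantelli lemma for events on disjoint blocks. The probability that
  blocks \<open>J\<close> to \<open>K - 1\<close> all fail is at most the product of the
  \<open>1 - p j\<close>, computed in the finite product law, and 1 - x <= exp (- x) brings in the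
  divergent sum.\<close>

lemma borel_cantelli_blocks:
  fixes t :: "nat \<Rightarrow> nat" and Q :: "nat \<Rightarrow> 'b list \<Rightarrow> bool"
  assumes fin: "finite (set_pmf \<nu>)" and t: "mono t"
    and div: "\<not> summable (\<lambda>j. measure_pmf.prob (replicate_pmf (t (Suc j) - t j) \<nu>) {xs. Q j xs})"
  shows "AE \<omega> in M. \<exists>\<^sub>\<infinity>j. Q j (map (\<lambda>i. Y i \<omega>) [Suc (t j)..<Suc (t (Suc j))])"
proof -
  define p where "p j = measure_pmf.prob (replicate_pmf (t (Suc j) - t j) \<nu>) {xs. Q j xs}" for j
  define blk where "blk j xs = drop (t j) (take (t (Suc j)) xs)" for j and xs :: "'b list"
  have p: "0 \<le> p j" "p j \<le> 1" for j by (simp_all add: p_def)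
  have product: "measure_pmf.prob (replicate_pmf (t K) \<nu>) {xs. \<forall>j\<in>{J..<K}. \<not> Q j (blk j xs)}
      \<le> (\<Prod>j\<in>{J..<K}. 1 - p j)" if "J \<le> K" for J K
    using that
  proof (induction K rule: dec_induct)
    case (step K)
    let ?d = "t (Suc K) - t K"
    have tK: "t (Suc K) = t K + ?d" using monoD[OF t, of K "Suc K"] by simp
    let ?R = "\<lambda>K xs. \<forall>j\<in>{J..<K}. \<not> Q j (blk j xs)"
    have "measure_pmf.prob (replicate_pmf (t K + ?d) \<nu>) {zs. ?R (Suc K) zs}
        = measure_pmf.expectation (replicate_pmf (t K) \<nu>)
            (\<lambda>xs. measure_pmf.prob (replicate_pmf ?d \<nu>) {ys. ?R (Suc K) (xs @ ys)})"
      by (rule prob_replicate_append[OF fin])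
    also have "\<dots> \<le> measure_pmf.expectation (replicate_pmf (t K) \<nu>) (\<lambda>xs. of_bool (?R K xs) * (1 - p K))"
    proof (intro expectation_mono_finite finite_set_replicate_pmf fin)
      fix xs assume "xs \<in> set_pmf (replicate_pmf (t K) \<nu>)"
      then have len: "length xs = t K" by (simp add: set_replicate_pmf)
      \<comment> \<open>Disjointness enters here: earlier blocks are read from \<open>xs\<close>
        alone, and block \<open>K\<close> from the fresh letters \<open>ys\<close>.\<close>
      have old: "blk j (xs @ ys) = blk j xs" if "j \<in> {J..<K}" for j ys
        using monoD[OF t, of "Suc j" K] that len by (simp add: blk_def)
      have new: "blk K (xs @ ys) = take ?d ys" for ys
        using len tK by (simp add: blk_def)
      show "measure_pmf.prob (replicate_pmf ?d \<nu>) {ys. ?R (Suc K) (xs @ ys)} \<le> of_bool (?R K xs) * (1 - p K)"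
      proof (cases "?R K xs")
        case True
        have "\<not> Q K ys" if "?R (Suc K) (xs @ ys)" "length ys = ?d" for ys
          using bspec[OF that(1), of K] that(2) new[of ys] step.hyps by simp
        then have "measure_pmf.prob (replicate_pmf ?d \<nu>) {ys. ?R (Suc K) (xs @ ys)}
            \<le> measure_pmf.prob (replicate_pmf ?d \<nu>) {ys. \<not> Q K ys}"
          by (intro measure_pmf.finite_measure_mono_AE) (auto simp: AE_measure_pmf_iff set_replicate_pmf)
        also have "\<dots> = 1 - p K"
          using measure_pmf.prob_neg[of "replicate_pmf ?d \<nu>" "Q K"] by (simp add: p_def)
        finally show ?thesis using True by simp
      next
        case False
        then have empty: "{ys. ?R (Suc K) (xs @ ys)} = {}" using old by (auto 4 3 intro: bexI[rotated])
        show ?thesis unfolding empty using p by simp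
      qed
    qed
    also have "\<dots> = measure_pmf.prob (replicate_pmf (t K) \<nu>) {xs. ?R K xs} * (1 - p K)"
      by (simp add: prob_eq_expectation)
    also have "\<dots> \<le> (\<Prod>j\<in>{J..<K}. 1 - p j) * (1 - p K)"
      using step.IH p by (intro mult_right_mono) auto
    also have "\<dots> = (\<Prod>j\<in>{J..<Suc K}. 1 - p j)"
      using step.hyps by simp
    finally show ?case unfolding tK[symmetric] .
  qed simp
  define bad where "bad J = {\<omega> \<in> space M. \<forall>j\<ge>J. \<not> Q j (map (\<lambda>i. Y i \<omega>) [Suc (t j)..<Suc (t (Suc j))])}" for J
  define bad' where "bad' J K = {\<omega> \<in> space M. \<forall>j\<in>{J..<K}. \<not> Q j (blk j (map (\<lambda>i. Y i \<omega>) [1..<Suc (t K)]))}" for J K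
  have bad'_events: "bad' J K \<in> events" for J K
    unfolding bad'_def by (rule prefix_events)
  have blk: "blk j (map (\<lambda>i. Y i \<omega>) [1..<Suc (t K)]) = map (\<lambda>i. Y i \<omega>) [Suc (t j)..<Suc (t (Suc j))]"
    if "j < K" for j K \<omega>
    using monoD[OF t, of "Suc j" K] that
    by (simp add: blk_def take_map drop_map take_upt drop_upt del: upt_Suc)
  have bad_eq: "bad J = (\<Inter>K. bad' J K)" for J
    using blk by (fastforce simp: bad_def bad'_def simp del: upt_Suc)
  have bad_events: "bad J \<in> events" for J
    unfolding bad_eq using bad'_events by auto
  have "prob (bad J) = 0" for J
  proof (rule ccontr)
    assume "prob (bad J) \<noteq> 0"
    then have pos: "prob (bad J) > 0" using measure_nonneg[of M "bad J"] by linarith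
    \<comment> \<open>A positive probability of \<open>bad J\<close> would bound all partial sums of
      the divergent series.\<close>
    have bound: "(\<Sum>j\<in>{J..<K}. p j) \<le> - ln (prob (bad J))" if "J \<le> K" for K
    proof -
      have "prob (bad J) \<le> prob (bad' J K)"
        unfolding bad_eq by (intro finite_measure_mono bad'_events) auto
      also have "\<dots> \<le> (\<Prod>j\<in>{J..<K}. 1 - p j)"
        unfolding bad'_def
        by (subst prefix_law[of "\<lambda>xs. \<forall>j\<in>{J..<K}. \<not> Q j (blk j xs)" "t K"]) (rule product[OF that])
      also have "\<dots> \<le> (\<Prod>j\<in>{J..<K}. exp (- p j))"
        using p by (intro prod_mono) (auto intro: order.trans[OF _ exp_ge_add_one_self])
      also have "\<dots> = exp (- (\<Sum>j\<in>{J..<K}. p j))"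
        by (simp add: exp_sum flip: sum_negf)
      finally have "ln (prob (bad J)) \<le> - (\<Sum>j\<in>{J..<K}. p j)"
        using ln_mono[OF _ pos] by fastforce
      then show ?thesis by simp
    qed
    have "summable (\<lambda>j. p (j + J))"
    proof (rule summableI_nonneg_bounded)
      show "(\<Sum>i<n. p (i + J)) \<le> - ln (prob (bad J))" for n
        using bound[of "n + J"] sum.shift_bounds_nat_ivl[of p 0 J n] by (simp add: atLeast0LessThan)
    qed (rule p)
    then show False using div by (simp add: p_def[symmetric] summable_iff_shift)
  qed
  then have "AE \<omega> in M. \<omega> \<notin> bad J" for J
    using bad_events AE_iff_measurable[of "bad J" M "\<lambda>\<omega>. \<omega> \<notin> bad J"] sets.sets_into_space
    by (fastforce simp: emeasure_eq_measure)
  then have "AE \<omega> in M. \<forall>J. \<omega> \<notin> bad J" by (simp add: AE_all_countable)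
  then show ?thesis
    using AE_space by eventually_elim (auto simp: bad_def INFM_nat_le simp del: upt_Suc)
qed

end

section \<open>The law of the iterated logarithm\<close>

locale centred_walk = iid_sequence M Y \<nu> + centred_step \<nu> B
  for M :: "'w measure" and Y :: "nat \<Rightarrow> 'w \<Rightarrow> real" and \<nu> B
begin

definition position :: "nat \<Rightarrow> 'w \<Rightarrow> real" where
  "position n \<omega> = sum_list (map (\<lambda>i. Y i \<omega>) [1..<Suc n])"

lemma sum_take_prefix: "k \<le> n \<Longrightarrow> sum_list (take k (map (\<lambda>i. Y i \<omega>) [1..<Suc n])) = position k \<omega>"
  by (simp add: position_def take_map take_upt del: upt_Suc)

lemma max_position_set_eq:
  "{\<omega> \<in> space M. \<exists>k\<le>n. a \<le> \<bar>position k \<omega>\<bar>}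
    = {\<omega> \<in> space M. (\<lambda>xs. \<exists>k\<le>n. a \<le> \<bar>sum_list (take k xs)\<bar>) (map (\<lambda>i. Y i \<omega>) [1..<Suc n])}"
  using sum_take_prefix[where n = n] by (auto simp del: upt_Suc)

lemma max_position_events: "{\<omega> \<in> space M. \<exists>k\<le>n. a \<le> \<bar>position k \<omega>\<bar>} \<in> events"
  unfolding max_position_set_eq by (rule prefix_events)

lemma prob_max_position_ge:
  assumes "a \<ge> 0" "n \<ge> 1"
  shows "prob {\<omega> \<in> space M. \<exists>k\<le>n. a \<le> \<bar>position k \<omega>\<bar>} \<le> 2 * exp (- (a\<^sup>2 / (2 * real n * B\<^sup>2)))"
  unfolding max_position_set_eq
  by (subst prefix_law[of "\<lambda>xs. \<exists>k\<le>n. a \<le> \<bar>sum_list (take k xs)\<bar>" n]) (rule prob_max_abs_ge[OF assms])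

text \<open>The first Borel--Cantelli lemma for maxima over the first 2^(j+1) steps. All
  \<open>k \<le> n\<close> are bounded at once, because the word length estimate asks for a bound
  along every prefix.\<close>

lemma lil_upper:
  "AE \<omega> in M. \<forall>\<^sub>F n in sequentially. \<forall>k\<le>n. \<bar>position k \<omega>\<bar> \<le> 4 * B * sqrt (real n * ln (ln (real n)))"
proof -
  \<comment> \<open>\<open>sqrt 8\<close> makes the Gaussian exponent at time 2^(j+1) equal to 2 ln
    (j + 1), so that the probabilities are at most 2 / (j + 1)^2.\<close>
  define a where "a j = sqrt 8 * B * sqrt (2 ^ j * ln (real (Suc j)))" for j
  define A where "A j = {\<omega> \<in> space M. \<exists>k\<le>2 ^ Suc j. a j \<le> \<bar>position k \<omega>\<bar>}" for j
  have a_nonneg: "a j \<ge> 0" for j using B_pos by (simp add: a_def)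
  have A_events: "A j \<in> events" for j unfolding A_def by (rule max_position_events)
  have prob_A: "prob (A j) \<le> 2 / (real (Suc j))\<^sup>2" for j
  proof -
    have "prob (A j) \<le> 2 * exp (- ((a j)\<^sup>2 / (2 * real (2 ^ Suc j) * B\<^sup>2)))"
      unfolding A_def using a_nonneg by (intro prob_max_position_ge) auto
    also have "(a j)\<^sup>2 / (2 * real (2 ^ Suc j) * B\<^sup>2) = 2 * ln (real (Suc j))"
      using B_pos by (simp add: a_def power_mult_distrib field_simps)
    also have "2 * exp (- (2 * ln (real (Suc j)))) = 2 / (real (Suc j))\<^sup>2"
      by (simp only: exp_minus exp_double exp_ln of_nat_0_less_iff zero_less_Suc) (simp add: field_simps)
    finally show ?thesis .
  qed
  have "summable (\<lambda>j. 1 / (real (Suc j))\<^sup>2)"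
    using inverse_power_summable[of 2, where ?'a = real]
    by (subst summable_Suc_iff[of "\<lambda>j. 1 / (real j)\<^sup>2"]) (simp add: inverse_eq_divide)
  then have "summable (\<lambda>j. 2 / (real (Suc j))\<^sup>2)"
    using summable_mult[of "\<lambda>j. 1 / (real (Suc j))\<^sup>2" 2] by simp
  then have "summable (\<lambda>j. prob (A j))"
    by (rule summable_comparison_test') (use prob_A in auto)
  then have "AE \<omega> in M. \<forall>\<^sub>F j in sequentially. \<omega> \<in> space M - A j"
    by (intro borel_cantelli_AE1 A_events) (auto simp: emeasure_eq_measure)
  then show ?thesis
  proof eventually_elim
    case (elim \<omega>)
    then obtain J where J: "\<omega> \<in> space M - A j" if "j \<ge> J" for j
      by (auto simp: eventually_sequentially)
    show ?case
    proof (rule eventually_sequentiallyI)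
      \<comment> \<open>From \<open>j \<ge> 4\<close> follows j + 1 <= (2 j / 3)^2 <= (ln n)^2, that
        is, ln (j + 1) <= 2 ln (ln n). This factor 2 and the 8 in \<open>a j\<close> make up the
        constant 4 = sqrt 16.\<close>
      fix n :: nat assume n: "2 ^ max J 4 \<le> n"
      then have "n \<ge> 1" using one_le_power[of "2::nat" "max J 4"] by linarith
      then obtain j where j: "2 ^ j \<le> n" "n < 2 ^ Suc j" using ex_power_ivl1[of 2 n] by auto
      have "(2::nat) ^ max J 4 < 2 ^ Suc j" using n j by linarith
      then have "max J 4 < Suc j" by (rule power_less_imp_less_exp[rotated]) simp
      then have j': "J \<le> j" "4 \<le> j" by auto
      have n_real: "2 ^ j \<le> real n" using j(1) by (metis of_nat_le_iff of_nat_numeral of_nat_power)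
      have "real j * (2 / 3) \<le> real j * ln 2" using ln2_ge_two_thirds by (intro mult_left_mono) auto
      also have "\<dots> = ln (2 ^ j)" by (simp add: ln_realpow)
      also have "\<dots> \<le> ln (real n)" using n_real by (intro ln_mono) auto
      finally have ln_n: "real j * (2 / 3) \<le> ln (real n)" .
      have "4 * real j \<le> real j * real j" using j'(2) by (intro mult_right_mono) auto
      moreover have "(real j * (2 / 3))\<^sup>2 = 4 / 9 * (real j * real j)"
        by (simp add: power2_eq_square)
      ultimately have "real (Suc j) \<le> (real j * (2 / 3))\<^sup>2"
        using j'(2) by linarith
      also have "\<dots> \<le> (ln (real n))\<^sup>2" using ln_n by (intro power_mono) auto
      finally have "ln (real (Suc j)) \<le> ln ((ln (real n))\<^sup>2)" by (intro ln_mono) auto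
      also have "\<dots> = 2 * ln (ln (real n))" using ln_n j' by (subst ln_realpow) auto
      finally have lnln: "ln (real (Suc j)) \<le> 2 * ln (ln (real n))" .
      have "a j \<le> sqrt 8 * B * sqrt (real n * (2 * ln (ln (real n))))"
        unfolding a_def using B_pos n_real lnln
        by (intro mult_left_mono real_sqrt_le_mono mult_mono) auto
      also have "\<dots> = sqrt (8 * 2) * B * sqrt (real n * ln (ln (real n)))"
        by (simp only: real_sqrt_mult ac_simps)
      also have "sqrt (8 * 2) = (4 :: real)" by (rule real_sqrt_unique) auto
      finally have a_le: "a j \<le> 4 * B * sqrt (real n * ln (ln (real n)))" .
      show "\<forall>k\<le>n. \<bar>position k \<omega>\<bar> \<le> 4 * B * sqrt (real n * ln (ln (real n)))"
      proof (intro allI impI)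
        fix k assume "k \<le> n"
        then have "k \<le> 2 ^ Suc j" using j by linarith
        then have "\<bar>position k \<omega>\<bar> < a j" using J[OF j'(1)] unfolding A_def by (blast intro: leI)
        with a_le show "\<bar>position k \<omega>\<bar> \<le> 4 * B * sqrt (real n * ln (ln (real n)))" by simp
      qed
    qed
  qed
qed

end

locale nondegenerate_walk = iid_sequence M Y \<nu> + nondegenerate_step \<nu> B
  for M :: "'w measure" and Y :: "nat \<Rightarrow> 'w \<Rightarrow> real" and \<nu> B
begin

sublocale centred_walk M Y \<nu> B ..

lemma prob_abs_position_gt:
  assumes "n \<ge> 1"
  shows "prob {\<omega> \<in> space M. esc_rate * sqrt n < \<bar>position n \<omega>\<bar>} \<ge> esc_prob"
  using prob_abs_sum_gt[OF assms] prefix_law[of "\<lambda>xs. esc_rate * sqrt n < \<bar>sum_list xs\<bar>" n]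
  by (simp add: position_def del: upt_Suc)

text \<open>In a block of length 2^j, about \<epsilon> ln (j + 1) consecutive escapes produce the
  extra factor of order sqrt (ln (j + 1)), with probability at least of order 1 / (j + 1). The
  harmonic series diverges and the blocks are disjoint.\<close>

lemma lil_lower:
  obtains c where "c > 0"
    "AE \<omega> in M. \<exists>\<^sub>\<infinity>n. c * sqrt (real n * ln (ln (real n))) \<le> \<bar>position n \<omega>\<bar>"
proof -
  define d where "d = esc_prob / 2"
  have "esc_prob \<le> 1"
    using prob_abs_sum_gt[of 1] measure_pmf.prob_le_1[of "steps 1"] by (meson order.refl order.trans)
  then have d: "0 < d" "d < 1" using esc_prob_pos by (auto simp: d_def)
  \<comment> \<open>\<open>\<epsilon> * ln d \<ge> - 1\<close> makes \<open>d\<close> to the power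
    \<epsilon> ln (j + 1) at least 1 / (j + 1), and \<open>\<epsilon> \<le> 1\<close> keeps the
    number \<open>k\<close> of escapes below 2^j. Rounding \<open>k\<close> up costs one more factor
    \<open>d\<close>.\<close>
  define \<epsilon> where "\<epsilon> = 1 / (1 - ln d)"
  have ln_d: "ln d < 0" using d by simp
  have \<epsilon>: "0 < \<epsilon>" "\<epsilon> \<le> 1" "\<epsilon> * ln d \<ge> - 1"
    using ln_d by (auto simp: \<epsilon>_def field_simps)
  define c1 where "c1 = esc_rate * sqrt (\<epsilon> / 2)"
  have c1: "c1 > 0" using esc_rate_pos \<epsilon> by (simp add: c1_def)
  define Q where "Q j xs \<longleftrightarrow> c1 * sqrt (2 ^ j * ln (real (Suc j))) \<le> sum_list xs" for j and xs :: "real list"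
  have block: "measure_pmf.prob (steps (2 ^ j)) {xs. Q j xs} \<ge> d / 2 * (1 / real (Suc j))" for j
  proof -
    define k where "k = Suc (nat \<lfloor>\<epsilon> * ln (real (Suc j))\<rfloor>)"
    have ln_nonneg: "0 \<le> \<epsilon> * ln (real (Suc j))" using \<epsilon> by simp
    have k_ge: "\<epsilon> * ln (real (Suc j)) \<le> real k" and k_le: "real k \<le> 1 + \<epsilon> * ln (real (Suc j))"
      using ln_nonneg unfolding k_def by linarith+
    have "\<epsilon> * ln (real (Suc j)) \<le> 1 * real j"
      using \<epsilon> ln_add_one_self_le_self[of "real j"] by (intro mult_mono) (auto simp: add.commute)
    then have "k \<le> Suc j" using k_le by linarith
    also have "\<dots> \<le> 2 ^ j" by (rule Suc_leI[OF less_exp])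
    finally have k: "1 \<le> k" "k \<le> 2 ^ j" by (auto simp: k_def)
    have "d * (1 / real (Suc j)) = d * exp (- 1 * ln (real (Suc j)))"
      by (simp add: exp_minus inverse_eq_divide)
    also have "\<dots> \<le> d * exp (\<epsilon> * ln d * ln (real (Suc j)))"
      using d by (intro mult_left_mono exp_le_cancel_iff[THEN iffD2] mult_right_mono \<epsilon>(3)) auto
    also have "\<dots> = d powr (1 + \<epsilon> * ln (real (Suc j)))"
      using d by (subst powr_add) (simp add: powr_def ac_simps)
    also have "\<dots> \<le> d powr real k"
      using d k_le by (intro powr_mono') auto
    also have "\<dots> = d ^ k" using d by (simp add: powr_realpow)
    finally have "d / 2 * (1 / real (Suc j)) \<le> d ^ k / 2" by linarith
    also have "\<dots> \<le> measure_pmf.prob (steps (2 ^ j)) {xs. esc_rate * sqrt (real (2 ^ j) * real k / 2) \<le> sum_list xs}"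
      unfolding d_def by (rule prob_sum_ge_blocks[OF k])
    also have "\<dots> \<le> measure_pmf.prob (steps (2 ^ j)) {xs. Q j xs}"
    proof -
      have "c1 * sqrt (2 ^ j * ln (real (Suc j))) = esc_rate * sqrt (2 ^ j * (\<epsilon> * ln (real (Suc j))) / 2)"
        by (simp add: c1_def real_sqrt_mult[symmetric] mult.assoc mult.left_commute)
      also have "\<dots> \<le> esc_rate * sqrt (real (2 ^ j) * real k / 2)"
        using k_ge esc_rate_pos
        by (intro mult_left_mono real_sqrt_le_mono divide_right_mono) auto
      finally show ?thesis
        by (intro measure_pmf.finite_measure_mono) (auto simp: Q_def)
    qed
    finally show ?thesis .
  qed
  have "\<not> summable (\<lambda>j. measure_pmf.prob (replicate_pmf (2 ^ Suc j - 2 ^ j) \<nu>) {xs. Q j xs})"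
  proof
    assume "summable (\<lambda>j. measure_pmf.prob (replicate_pmf (2 ^ Suc j - 2 ^ j) \<nu>) {xs. Q j xs})"
    then have "summable (\<lambda>j. d / 2 * (1 / real (Suc j)))"
      by (rule summable_comparison_test') (use block d in auto)
    then have "summable (\<lambda>j. 1 / real (Suc j))"
      using d by (simp only: summable_cmult_iff) simp
    then show False
      using not_summable_harmonic[where 'a = real] summable_Suc_iff[of "\<lambda>j. 1 / real j"]
      by (simp add: inverse_eq_divide)
  qed
  then have "AE \<omega> in M. \<exists>\<^sub>\<infinity>j. Q j (map (\<lambda>i. Y i \<omega>) [Suc (2 ^ j)..<Suc (2 ^ Suc j)])"
    by (intro borel_cantelli_blocks finite_support) (auto intro!: monoI power_increasing)
  \<comment> \<open>A large increment over a block forces one of its two end points to be at least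
    half as large, whence the 2; \<open>sqrt 2\<close> accounts for n <= 2 * 2^j.\<close>
  then have "AE \<omega> in M. \<exists>\<^sub>\<infinity>n. c1 / (2 * sqrt 2) * sqrt (real n * ln (ln (real n))) \<le> \<bar>position n \<omega>\<bar>"
  proof eventually_elim
    case (elim \<omega>)
    show ?case unfolding INFM_nat_le
    proof
      fix m
      obtain j where j: "j \<ge> max m 2" "Q j (map (\<lambda>i. Y i \<omega>) [Suc (2 ^ j)..<Suc (2 ^ Suc j)])"
        using elim unfolding INFM_nat_le by blast
      have "[1..<Suc (2 ^ Suc j)] = [1..<Suc (2 ^ j)] @ [Suc (2 ^ j)..<Suc (2 ^ Suc j)]"
        using upt_add_eq_append[of 1 "Suc (2 ^ j)" "2 ^ j"] by (simp add: mult_2 del: upt_Suc)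
      then have "position (2 ^ Suc j) \<omega>
          = position (2 ^ j) \<omega> + sum_list (map (\<lambda>i. Y i \<omega>) [Suc (2 ^ j)..<Suc (2 ^ Suc j)])"
        by (simp add: position_def del: upt_Suc)
      then have "c1 * sqrt (2 ^ j * ln (real (Suc j))) \<le> \<bar>position (2 ^ Suc j) \<omega>\<bar> + \<bar>position (2 ^ j) \<omega>\<bar>"
        using j(2) unfolding Q_def by linarith
      then have "c1 / 2 * sqrt (2 ^ j * ln (real (Suc j))) \<le> \<bar>position (2 ^ Suc j) \<omega>\<bar>
          \<or> c1 / 2 * sqrt (2 ^ j * ln (real (Suc j))) \<le> \<bar>position (2 ^ j) \<omega>\<bar>"
        by linarith
      then obtain n where n: "n = 2 ^ Suc j \<or> n = 2 ^ j"
        "c1 / 2 * sqrt (2 ^ j * ln (real (Suc j))) \<le> \<bar>position n \<omega>\<bar>"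
        by blast
      have n_ge: "2 ^ j \<le> n" and n_le: "n \<le> 2 ^ Suc j" using n(1) by auto
      have "j < 2 ^ j" by (rule less_exp)
      then have "j < n" using n_ge by linarith
      have n2: "real n \<le> 2 * 2 ^ j" using n_le by (metis of_nat_le_iff of_nat_numeral of_nat_power power_Suc)
      have "real n \<ge> 3" using \<open>j < n\<close> j(1) by linarith
      then have ln_n: "0 < ln (real n)" by simp
      have "ln (real n) \<le> ln (2 ^ Suc j)" using n2 \<open>real n \<ge> 3\<close> by (intro ln_mono) auto
      also have "\<dots> = real (Suc j) * ln 2" by (rule ln_realpow)
      also have "\<dots> \<le> real (Suc j) * 1" using ln2_le_25_over_36 by (intro mult_left_mono) auto
      finally have "ln (ln (real n)) \<le> ln (real (Suc j))" using ln_n by (intro ln_mono) auto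
      then have "real n * ln (ln (real n)) \<le> real n * ln (real (Suc j))"
        by (intro mult_left_mono) auto
      also have "\<dots> \<le> (2 * 2 ^ j) * ln (real (Suc j))"
        using n2 by (intro mult_right_mono) auto
      finally have "real n * ln (ln (real n)) \<le> (2 * 2 ^ j) * ln (real (Suc j))" .
      then have "sqrt (real n * ln (ln (real n))) \<le> sqrt (2 * (2 ^ j * ln (real (Suc j))))"
        by (simp add: mult.assoc)
      then have "c1 / (2 * sqrt 2) * sqrt (real n * ln (ln (real n)))
          \<le> c1 / (2 * sqrt 2) * (sqrt 2 * sqrt (2 ^ j * ln (real (Suc j))))"
        using c1 by (intro mult_left_mono) (auto simp: real_sqrt_mult)
      also have "\<dots> = c1 / 2 * sqrt (2 ^ j * ln (real (Suc j)))" by simp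
      finally show "\<exists>n\<ge>m. c1 / (2 * sqrt 2) * sqrt (real n * ln (ln (real n))) \<le> \<bar>position n \<omega>\<bar>"
        using n(2) \<open>j < n\<close> j(1) by (intro exI[of _ n]) auto
    qed
  qed
  with c1 show ?thesis by (intro that[of "c1 / (2 * sqrt 2)"]) auto
qed

end

section \<open>Walks controlled by their coordinates\<close>

lemma pl_ext_eq:
  "pl_ext f x = (1 - frac x) * f (nat \<lfloor>x\<rfloor>) + frac x * f (Suc (nat \<lfloor>x\<rfloor>))"
  by (simp add: pl_ext_def frac_def algebra_simps)

lemma pl_ext_cmult: "pl_ext (\<lambda>n. c * f n) x = c * pl_ext f x"
  by (simp add: pl_ext_eq algebra_simps)

lemma pl_ext_le_pl_ext: "(\<And>n. f n \<le> g n) \<Longrightarrow> pl_ext f x \<le> pl_ext g x"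
  unfolding pl_ext_eq using frac_lt_1[of x] by (intro add_mono mult_left_mono) auto

lemma pl_ext_mono:
  assumes "mono f" "0 \<le> x" "x \<le> y"
  shows "pl_ext f x \<le> pl_ext f y"
proof (cases "\<lfloor>x\<rfloor> = \<lfloor>y\<rfloor>")
  case True
  have "f (nat \<lfloor>y\<rfloor>) \<le> f (Suc (nat \<lfloor>y\<rfloor>))" using assms(1) by (simp add: monoD)
  then show ?thesis
    using True assms(3) by (simp add: pl_ext_def mult_right_mono)
next
  case False
  then have less: "\<lfloor>x\<rfloor> < \<lfloor>y\<rfloor>" using assms(3) by (meson floor_mono order_le_less)
  have t: "0 \<le> frac z" "frac z \<le> 1" for z :: real using frac_lt_1[of z] by auto
  have "pl_ext f x \<le> (1 - frac x) * f (Suc (nat \<lfloor>x\<rfloor>)) + frac x * f (Suc (nat \<lfloor>x\<rfloor>))"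
    unfolding pl_ext_eq using t[of x] assms(1) by (intro add_mono mult_left_mono monoD[OF assms(1)]) auto
  also have "\<dots> = f (Suc (nat \<lfloor>x\<rfloor>))" by (simp add: algebra_simps)
  also have "\<dots> \<le> f (nat \<lfloor>y\<rfloor>)"
    using less assms(2) by (intro monoD[OF assms(1)]) linarith
  also have "\<dots> = (1 - frac y) * f (nat \<lfloor>y\<rfloor>) + frac y * f (nat \<lfloor>y\<rfloor>)" by (simp add: algebra_simps)
  also have "\<dots> \<le> pl_ext f y"
    unfolding pl_ext_eq using t[of y] by (intro add_mono mult_left_mono monoD[OF assms(1)]) auto
  finally show ?thesis .
qed

lemma pl_ext_nonneg: "(\<And>n. 0 \<le> f n) \<Longrightarrow> 0 \<le> pl_ext f x"
  using pl_ext_le_pl_ext[of "\<lambda>_. 0" f x] by (simp add: pl_ext_def)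

text \<open>The same constant has to act as a factor and as a dilation. Taken at least 1, its
  dilation is absorbed by the monotone \<open>g\<close>, and \<open>f\<close> is compared with
  \<open>g\<close> pointwise before extending.\<close>

lemma growth_equivI:
  assumes g: "mono g" "\<And>n. 0 \<le> g n"
    and a: "a > 0" "\<And>n. a * g n \<le> f n" and b: "\<And>n. f n \<le> b * g n"
  shows "growth_equiv f g"
  unfolding growth_equiv_def growth_le_def
proof
  define c where "c = max 1 b"
  have "pl_ext f x \<le> c * pl_ext g (c * x)" if "x \<ge> 0" for x
  proof -
    have "pl_ext f x \<le> pl_ext (\<lambda>n. c * g n) x"
    proof (rule pl_ext_le_pl_ext)
      show "f n \<le> c * g n" for n
        using b[of n] mult_right_mono[of b c "g n"] g(2) by (simp add: c_def)
    qed
    also have "\<dots> = c * pl_ext g x" by (rule pl_ext_cmult)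
    also have "\<dots> \<le> c * pl_ext g (c * x)"
      using that mult_right_mono[of 1 c x] by (intro mult_left_mono pl_ext_mono g) (auto simp: c_def)
    finally show ?thesis .
  qed
  then show "\<exists>c>0. \<forall>x\<ge>0. pl_ext f x \<le> c * pl_ext g (c * x)"
    by (intro exI[of _ c]) (auto simp: c_def)
next
  define c where "c = max 1 (1 / a)"
  have c: "c \<ge> 1" "1 \<le> c * a" using a(1) by (auto simp: c_def max_def field_simps)
  have "pl_ext g x \<le> c * pl_ext f (c * x)" if "x \<ge> 0" for x
  proof -
    have "pl_ext g x \<le> pl_ext g (c * x)"
      using that mult_right_mono[of 1 c x] c by (intro pl_ext_mono g) auto
    also have "\<dots> \<le> (c * a) * pl_ext g (c * x)"
      using mult_right_mono[OF c(2) pl_ext_nonneg[where x = "c * x", OF g(2)]] by simp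
    also have "\<dots> = c * pl_ext (\<lambda>n. a * g n) (c * x)" by (simp add: pl_ext_cmult)
    also have "\<dots> \<le> c * pl_ext f (c * x)"
      using c a(2) by (intro mult_left_mono pl_ext_le_pl_ext) auto
    finally show ?thesis .
  qed
  then show "\<exists>c>0. \<forall>x\<ge>0. pl_ext g x \<le> c * pl_ext f (c * x)"
    using c by (intro exI[of _ c]) auto
qed

text \<open>A discrete layer-cake formula: integrated, it bounds an expectation by tail
  probabilities. The cutoff \<open>m\<close> keeps the sum finite.\<close>

lemma le_one_plus_count:
  assumes "u \<le> real m"
  shows "u \<le> 1 + (\<Sum>k\<in>{1..m}. of_bool (real k < u))"
proof (cases "u \<le> 1")
  case True
  have "0 \<le> (\<Sum>k\<in>{1..m}. of_bool (real k < u) :: real)" by (intro sum_nonneg) auto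
  with True show ?thesis by linarith
next
  case False
  have "1 \<le> nat \<lceil>u\<rceil>" using False by linarith
  then have "u - 1 \<le> real (card {1..<nat \<lceil>u\<rceil>})"
    using real_nat_ceiling_ge[of u] by (simp add: of_nat_diff)
  also have "\<dots> = (\<Sum>k\<in>{1..<nat \<lceil>u\<rceil>}. 1)" by simp
  also have "\<dots> = (\<Sum>k\<in>{1..<nat \<lceil>u\<rceil>}. of_bool (real k < u))"
    by (intro sum.cong) (auto simp: less_ceiling_iff zless_nat_eq_int_zless)
  also have "\<dots> \<le> (\<Sum>k\<in>{1..m}. of_bool (real k < u))"
  proof (intro sum_mono2)
    show "{1..<nat \<lceil>u\<rceil>} \<subseteq> {1..m}" using assms by (auto simp: zless_nat_eq_int_zless less_ceiling_iff)
  qed auto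
  finally show ?thesis by simp
qed

text \<open>This interface separates the probability from the group. \<open>L_upper\<close> and
  \<open>L_linear\<close> hold almost surely, because the steps lie in the support of the law almost
  surely; \<open>L_lower\<close> holds everywhere, because the steps always lie in the group.
  \<open>D\<close> provides integrability.\<close>

locale controlled_walk = prob_space M for M :: "'w measure" +
  fixes Y :: "nat \<Rightarrow> nat \<Rightarrow> 'w \<Rightarrow> real" and \<nu> :: "nat \<Rightarrow> real pmf" and B :: real and r :: nat
    and L :: "nat \<Rightarrow> 'w \<Rightarrow> nat" and C K :: real and D :: nat
  assumes r_pos: "r > 0"
    and coordinate: "j < r \<Longrightarrow> centred_walk M (Y j) (\<nu> j) B"
    and nondeg: "nondegenerate_walk M (Y 0) (\<nu> 0) B"
    and L_events: "{\<omega> \<in> space M. P (L n \<omega>)} \<in> events"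
    and C_pos: "C > 0" and K_pos: "K > 0"
    and L_upper: "AE \<omega> in M. \<forall>R n. 0 \<le> R \<longrightarrow>
      (\<forall>k\<le>n. \<forall>j<r. \<bar>centred_walk.position (Y j) k \<omega>\<bar> \<le> R) \<longrightarrow>
      real (L n \<omega>) \<le> C * (R + ln (real n + 1) + 1)"
    and L_lower: "\<omega> \<in> space M \<Longrightarrow> \<bar>centred_walk.position (Y 0) n \<omega>\<bar> \<le> K * real (L n \<omega>)"
    and L_linear: "AE \<omega> in M. \<forall>n. L n \<omega> \<le> D * n"
    and L_0: "\<omega> \<in> space M \<Longrightarrow> L 0 \<omega> = 0"
begin

sublocale first: nondegenerate_walk M "Y 0" "\<nu> 0" B by (rule nondeg)

abbreviation pos :: "nat \<Rightarrow> nat \<Rightarrow> 'w \<Rightarrow> real" where "pos j \<equiv> centred_walk.position (Y j)"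

lemma B_pos: "B > 0" by (rule first.B_pos)

text \<open>From n + 1 <= (1 + sqrt n)^2. It places the logarithmic error of \<open>L_upper\<close>
  on the diffusive scale.\<close>

lemma ln_le_sqrt:
  assumes "n \<ge> 1"
  shows "ln (real n + 1) + 1 \<le> 3 * sqrt n"
proof -
  have "ln (real n + 1) \<le> ln ((1 + sqrt n)\<^sup>2)"
    by (intro ln_mono) (auto simp: power2_eq_square algebra_simps)
  also have "\<dots> = 2 * ln (1 + sqrt n)" by (subst ln_realpow) auto
  also have "\<dots> \<le> 2 * sqrt n" by (intro mult_left_mono ln_add_one_self_le_self) auto
  finally have "ln (real n + 1) \<le> 2 * sqrt n" .
  moreover have "1 \<le> sqrt n" using assms by simp
  ultimately show ?thesis by linarith
qed

text \<open>Half of x sqrt n is allotted to the running maxima and half to the logarithmic error,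
  which fits into its share once x > 6 C. Then some coordinate reaches \<open>y\<close>, and a union
  bound over the coordinates applies.\<close>

lemma tail_bound:
  obtains c A where "c > 0" "A > 0"
    "\<And>n x. n \<ge> 1 \<Longrightarrow> x \<ge> 0 \<Longrightarrow> prob {\<omega> \<in> space M. real (L n \<omega>) > x * sqrt n} \<le> A * exp (- c * x\<^sup>2)"
proof -
  \<comment> \<open>\<open>c\<close> is the quotient of y^2 / (2 n B^2) by x^2. In \<open>A\<close>,
    the term \<open>2 * real r\<close> comes from the union bound, and the exponential makes the
    claim trivial for x <= 6 C.\<close>
  define c where "c = 1 / (8 * C\<^sup>2 * B\<^sup>2)"
  define A where "A = 2 * real r + exp (c * (6 * C)\<^sup>2)"
  have c: "c > 0" using C_pos B_pos by (simp add: c_def)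
  have A: "A > 0" by (simp add: A_def add_nonneg_pos)
  have "prob {\<omega> \<in> space M. real (L n \<omega>) > x * sqrt n} \<le> A * exp (- c * x\<^sup>2)"
    if n: "n \<ge> 1" and x: "x \<ge> 0" for n x
  proof (cases "x \<le> 6 * C")
    case True
    have "1 \<le> exp (c * (6 * C)\<^sup>2) * exp (- c * x\<^sup>2)"
      using power_mono[OF True x, of 2] c by (simp add: exp_add[symmetric] power_mult_distrib)
    also have "\<dots> \<le> A * exp (- c * x\<^sup>2)" by (intro mult_right_mono) (auto simp: A_def)
    finally show ?thesis by (intro order.trans[OF prob_le_1])
  next
    case False
    define y where "y = x * sqrt n / (2 * C)"
    define E where "E j = {\<omega> \<in> space M. \<exists>k\<le>n. y \<le> \<bar>pos j k \<omega>\<bar>}" for j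
    have y: "y \<ge> 0" using x C_pos by (simp add: y_def)
    have E: "E j \<in> events" "prob (E j) \<le> 2 * exp (- c * x\<^sup>2)" if "j < r" for j
    proof -
      interpret centred_walk M "Y j" "\<nu> j" B by (rule coordinate[OF that])
      show "E j \<in> events" unfolding E_def by (rule max_position_events)
      have "prob (E j) \<le> 2 * exp (- (y\<^sup>2 / (2 * real n * B\<^sup>2)))"
        unfolding E_def by (rule prob_max_position_ge[OF y n])
      also have "y\<^sup>2 / (2 * real n * B\<^sup>2) = c * x\<^sup>2"
        using n C_pos B_pos by (simp add: y_def c_def power_mult_distrib power_divide)
      finally show "prob (E j) \<le> 2 * exp (- c * x\<^sup>2)" by simp
    qed
    have "prob {\<omega> \<in> space M. real (L n \<omega>) > x * sqrt n} \<le> prob (\<Union>j\<in>{..<r}. E j)"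
    proof (rule finite_measure_mono_AE)
      show "AE \<omega> in M. \<omega> \<in> {\<omega> \<in> space M. real (L n \<omega>) > x * sqrt n} \<longrightarrow> \<omega> \<in> (\<Union>j\<in>{..<r}. E j)"
        using L_upper
      proof eventually_elim
        case (elim \<omega>)
        show ?case
        proof (rule impI, rule ccontr)
          assume \<omega>: "\<omega> \<in> {\<omega> \<in> space M. real (L n \<omega>) > x * sqrt n}"
            and "\<omega> \<notin> (\<Union>j\<in>{..<r}. E j)"
          then have "\<bar>pos j k \<omega>\<bar> \<le> y" if "k \<le> n" "j < r" for k j
            using that by (fastforce simp: E_def not_le)
          then have "real (L n \<omega>) \<le> C * (y + ln (real n + 1) + 1)"
            using elim y by blast
          also have "\<dots> \<le> C * (y + 3 * sqrt n)"
            using ln_le_sqrt[OF n] C_pos by (intro mult_left_mono) auto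
          also have "\<dots> = x * sqrt n / 2 + (6 * C) * sqrt n / 2"
            using C_pos by (simp add: y_def field_simps)
          also have "\<dots> \<le> x * sqrt n / 2 + x * sqrt n / 2"
            using False by (intro add_left_mono divide_right_mono mult_right_mono) auto
          finally show False using \<omega> by simp
        qed
      qed
    qed (use E(1) in auto)
    also have "\<dots> \<le> (\<Sum>j\<in>{..<r}. prob (E j))"
      using E(1) by (intro finite_measure_subadditive_finite) auto
    also have "\<dots> \<le> (\<Sum>j\<in>{..<r}. 2 * exp (- c * x\<^sup>2))"
      using E(2) by (intro sum_mono) auto
    also have "\<dots> = (2 * real r) * exp (- c * x\<^sup>2)" by simp
    also have "\<dots> \<le> A * exp (- c * x\<^sup>2)" by (intro mult_right_mono) (auto simp: A_def)
    finally show ?thesis .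
  qed
  with c A show ?thesis by (rule that)
qed

lemma prob_L_gt:
  assumes "n \<ge> 1"
  shows "prob {\<omega> \<in> space M. real (L n \<omega>) > first.esc_rate / K * sqrt n} \<ge> first.esc_prob"
proof -
  have "prob {\<omega> \<in> space M. first.esc_rate * sqrt n < \<bar>pos 0 n \<omega>\<bar>}
      \<le> prob {\<omega> \<in> space M. real (L n \<omega>) > first.esc_rate / K * sqrt n}"
  proof (intro finite_measure_mono L_events subsetI CollectI conjI)
    fix \<omega> assume "\<omega> \<in> {\<omega> \<in> space M. first.esc_rate * sqrt n < \<bar>pos 0 n \<omega>\<bar>}"
    then have "\<omega> \<in> space M" "first.esc_rate * sqrt n < K * real (L n \<omega>)"
      using L_lower[of \<omega> n] by auto
    then show "\<omega> \<in> space M" "real (L n \<omega>) > first.esc_rate / K * sqrt n"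
      using K_pos by (auto simp: field_simps)
  qed
  with first.prob_abs_position_gt[OF assms] show ?thesis by linarith
qed

theorem tight: "tight_degree_of_escape M L (1/2)"
  unfolding tight_degree_of_escape_def
proof (intro conjI)
  show "\<exists>\<gamma>>0. \<exists>\<delta>>0. \<forall>n\<ge>1. \<delta> \<le> prob {\<omega> \<in> space M. \<gamma> * real n powr (1 / 2) < real (L n \<omega>)}"
    using prob_L_gt first.esc_rate_pos first.esc_prob_pos K_pos
    by (intro exI[of _ "first.esc_rate / K"] exI[of _ first.esc_prob] conjI) (auto simp: powr_half_sqrt)
  obtain c A where cA: "c > 0" "A > 0"
    "\<And>n x. n \<ge> 1 \<Longrightarrow> x \<ge> 0 \<Longrightarrow> prob {\<omega> \<in> space M. real (L n \<omega>) > x * sqrt n} \<le> A * exp (- c * x\<^sup>2)"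
    using tail_bound by blast
  have "prob {\<omega> \<in> space M. x * real n powr (1 / 2) < real (L n \<omega>)} \<le> A * exp (- c * x powr 2)"
    if "x \<ge> 0" for x n
  proof (cases "n = 0")
    case True
    \<comment> \<open>The tail bound starts at n = 1. At n = 0 the threshold is 0, since
      \<open>0 powr (1/2) = 0\<close>, and \<open>L 0\<close> does not exceed it.\<close>
    have "{\<omega> \<in> space M. x * real n powr (1 / 2) < real (L n \<omega>)} = {}"
      using True by (auto simp: L_0)
    then show ?thesis using cA(2) by (simp only: measure_empty) simp
  next
    case False
    then show ?thesis using cA(3)[of n x] that by (simp add: powr_half_sqrt)
  qed
  with cA show "\<exists>\<beta>>0. \<exists>c>0. \<exists>C>0. \<forall>x\<ge>0. \<forall>n.
      prob {\<omega> \<in> space M. x * real n powr (1 / 2) < real (L n \<omega>)} \<le> C * exp (- c * x powr \<beta>)"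
    by (intro exI[of _ 2] exI[of _ c] exI[of _ A] conjI) auto
qed

lemma L_measurable: "(\<lambda>\<omega>. real (L n \<omega>)) \<in> borel_measurable M"
proof -
  have "L n \<in> measurable M (count_space UNIV)"
    using L_events[of "\<lambda>x. x \<in> A" n for A]
    by (intro measurableI) (auto simp: vimage_def Collect_conj_eq Int_commute)
  from measurable_compose[OF this, of real borel] show ?thesis by simp
qed

lemma integrable_L: "integrable M (\<lambda>\<omega>. real (L n \<omega>))"
proof (rule integrable_const_bound[of _ "real (D * n)"])
  show "AE \<omega> in M. norm (real (L n \<omega>)) \<le> real (D * n)"
    using L_linear by eventually_elim (simp flip: of_nat_mult)
qed (rule L_measurable)

lemma expectation_of_bool_L:
  "expectation (\<lambda>\<omega>. of_bool (P (L n \<omega>))) = prob {\<omega> \<in> space M. P (L n \<omega>)}"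
  "integrable M (\<lambda>\<omega>. of_bool (P (L n \<omega>)) :: real)"
proof -
  have eq: "of_bool (P (L n \<omega>)) = indicat_real {\<omega> \<in> space M. P (L n \<omega>)} \<omega>" if "\<omega> \<in> space M" for \<omega>
    using that by simp
  have "expectation (\<lambda>\<omega>. of_bool (P (L n \<omega>))) = expectation (indicat_real {\<omega> \<in> space M. P (L n \<omega>)})"
    by (intro Bochner_Integration.integral_cong refl eq)
  then show "expectation (\<lambda>\<omega>. of_bool (P (L n \<omega>))) = prob {\<omega> \<in> space M. P (L n \<omega>)}"
    using L_events by simp
  have "integrable M (indicat_real {\<omega> \<in> space M. P (L n \<omega>)})"
    using L_events by (simp add: emeasure_eq_measure)
  then show "integrable M (\<lambda>\<omega>. of_bool (P (L n \<omega>)) :: real)"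
    by (subst Bochner_Integration.integrable_cong[OF refl eq])
qed

theorem displacement: "displacement_exponent M L (1/2)"
proof -
  obtain c A where cA: "c > 0" "A > 0"
    "\<And>n x. n \<ge> 1 \<Longrightarrow> x \<ge> 0 \<Longrightarrow> prob {\<omega> \<in> space M. real (L n \<omega>) > x * sqrt n} \<le> A * exp (- c * x\<^sup>2)"
    using tail_bound by blast
  \<comment> \<open>The tails at the levels k sqrt n, with k^2 weakened to k, form a geometric
    series whose sum does not depend on n.\<close>
  define b where "b = 1 + A * (\<Sum>k. exp (- c) ^ k)"
  have lower: "(first.esc_rate / K * first.esc_prob) * sqrt n \<le> expectation (\<lambda>\<omega>. real (L n \<omega>))" for n
  proof (cases "n = 0")
    case False
    let ?g = "first.esc_rate / K * sqrt n"
    have g: "?g \<ge> 0" using first.esc_rate_pos K_pos by simp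
    have "?g * first.esc_prob \<le> ?g * prob {\<omega> \<in> space M. real (L n \<omega>) > ?g}"
      using False g by (intro mult_left_mono prob_L_gt) auto
    also have "\<dots> = expectation (\<lambda>\<omega>. ?g * of_bool (real (L n \<omega>) > ?g))"
      using expectation_of_bool_L(1)[of "\<lambda>l. real l > ?g" n] by simp
    also have "\<dots> \<le> expectation (\<lambda>\<omega>. real (L n \<omega>))"
      using expectation_of_bool_L(2)[of "\<lambda>l. real l > ?g" n] g
      by (intro integral_mono integrable_L integrable_mult_right) auto
    finally show ?thesis by (simp add: mult_ac)
  qed simp
  have upper: "expectation (\<lambda>\<omega>. real (L n \<omega>)) \<le> b * sqrt n" for n
  proof (cases "n = 0")
    case True
    have "expectation (\<lambda>\<omega>. real (L 0 \<omega>)) = expectation (\<lambda>\<omega>. 0)"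
      by (intro Bochner_Integration.integral_cong) (auto simp: L_0)
    then show ?thesis using True by simp
  next
    case False
    let ?m = "D * n" and ?s = "sqrt (real n)"
    have s: "?s \<ge> 1" using False by simp
    let ?h = "\<lambda>\<omega>. ?s * (1 + (\<Sum>k\<in>{1..?m}. of_bool (real (L n \<omega>) > real k * ?s)))"
    have "expectation (\<lambda>\<omega>. real (L n \<omega>)) \<le> expectation ?h"
    proof (intro integral_mono_AE integrable_L)
      show "integrable M ?h"
        using expectation_of_bool_L(2)[of "\<lambda>l. real l > real k * ?s" n for k]
        by (intro integrable_mult_right Bochner_Integration.integrable_add integrable_const
            Bochner_Integration.integrable_sum)
      show "AE \<omega> in M. real (L n \<omega>) \<le> ?h \<omega>"
        using L_linear
      proof eventually_elim
        case (elim \<omega>)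
        have "real (L n \<omega>) \<le> real ?m" using elim by (simp only: of_nat_le_iff)
        also have "\<dots> \<le> real ?m * ?s" using s mult_left_mono[of 1 ?s "real ?m"] by simp
        finally have "real (L n \<omega>) / ?s \<le> real ?m" using s by (simp add: field_simps)
        then have "real (L n \<omega>) / ?s \<le> 1 + (\<Sum>k\<in>{1..?m}. of_bool (real k < real (L n \<omega>) / ?s))"
          by (rule le_one_plus_count)
        moreover have "real k < real (L n \<omega>) / ?s \<longleftrightarrow> real (L n \<omega>) > real k * ?s" for k
          using s False by (simp add: less_divide_eq)
        ultimately show ?case
          using s False by (simp add: divide_le_eq mult.commute)
      qed
    qed
    also have "\<dots> = ?s * (1 + (\<Sum>k\<in>{1..?m}. prob {\<omega> \<in> space M. real (L n \<omega>) > real k * ?s}))"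
    proof -
      have "expectation (\<lambda>\<omega>. of_bool (real (L n \<omega>) > real k * ?s)) = prob {\<omega> \<in> space M. real (L n \<omega>) > real k * ?s}"
        "integrable M (\<lambda>\<omega>. of_bool (real (L n \<omega>) > real k * ?s) :: real)" for k
        using expectation_of_bool_L[of "\<lambda>l. real l > real k * ?s" n] by simp_all
      then show ?thesis
        by (subst integral_mult_right_zero, subst Bochner_Integration.integral_add)
           (simp_all add: prob_space del: sum_of_bool_eq)
    qed
    also have "\<dots> \<le> ?s * (1 + (\<Sum>k\<in>{1..?m}. A * exp (- c) ^ k))"
    proof (intro mult_left_mono add_left_mono sum_mono)
      fix k :: nat assume "k \<in> {1..?m}"
      have "prob {\<omega> \<in> space M. real (L n \<omega>) > real k * ?s} \<le> A * exp (- c * (real k)\<^sup>2)"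
        using False by (intro cA(3)) auto
      also have "\<dots> \<le> A * exp (real k * - c)"
      proof -
        have "real k \<le> (real k)\<^sup>2" by (cases k) (auto simp: power2_eq_square)
        then show ?thesis using cA(1,2) by (auto simp: mult.commute intro!: mult_left_mono)
      qed
      also have "\<dots> = A * exp (- c) ^ k" by (simp only: exp_of_nat_mult)
      finally show "prob {\<omega> \<in> space M. real (L n \<omega>) > real k * ?s} \<le> A * exp (- c) ^ k" .
    qed simp
    also have "\<dots> \<le> ?s * b"
    proof -
      have "(\<Sum>k\<in>{1..?m}. exp (- c) ^ k) \<le> (\<Sum>k. exp (- c) ^ k)"
        using cA(1) by (intro sum_le_suminf summable_geometric) auto
      then show ?thesis
        unfolding b_def sum_distrib_left[symmetric] using cA(2) by (intro mult_left_mono add_left_mono) auto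
    qed
    finally show ?thesis by (simp add: mult.commute)
  qed
  have "growth_equiv (\<lambda>n. expectation (\<lambda>\<omega>. real (L n \<omega>))) (\<lambda>n. sqrt (real n))"
  proof (rule growth_equivI)
    show "first.esc_rate / K * first.esc_prob > 0"
      using first.esc_rate_pos first.esc_prob_pos K_pos by simp
  qed (use lower upper in \<open>auto intro: monoI\<close>)
  then show ?thesis unfolding displacement_exponent_def by (simp add: powr_half_sqrt)
qed

theorem iterated_log: "law_of_iterated_log M L (1/2)"
proof -
  let ?s = "\<lambda>n. sqrt (real n * ln (ln (real n)))"
  let ?f = "\<lambda>\<omega> n. ereal (real (L n \<omega>) / (real n * ln (ln (real n))) powr (1/2))"
  \<comment> \<open>\<open>powr (1/2)\<close> is identified with the root for nonnegative arguments
    only, and ln (ln n) is negative for small n; positivity holds eventually.\<close>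
  have half: "x powr (1/2) = sqrt x" if "sqrt x > 0" for x :: real
    using that by (simp add: powr_half_sqrt)
  have s_pos: "\<forall>\<^sub>F n in sequentially. ?s n > 0" by real_asymp
  have s_ln: "\<forall>\<^sub>F n in sequentially. ln (real n + 1) + 1 \<le> ?s n" by real_asymp
  obtain c where c: "c > 0" "AE \<omega> in M. \<exists>\<^sub>\<infinity>n. c * ?s n \<le> \<bar>pos 0 n \<omega>\<bar>"
    using first.lil_lower by blast
  have "AE \<omega> in M. \<forall>j\<in>{..<r}. \<forall>\<^sub>F n in sequentially. \<forall>k\<le>n. \<bar>pos j k \<omega>\<bar> \<le> 4 * B * ?s n"
  proof (rule AE_finite_allI)
    fix j assume "j \<in> {..<r}"
    then interpret centred_walk M "Y j" "\<nu> j" B using coordinate by simp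
    show "AE \<omega> in M. \<forall>\<^sub>F n in sequentially. \<forall>k\<le>n. \<bar>pos j k \<omega>\<bar> \<le> 4 * B * ?s n"
      by (rule lil_upper)
  qed simp
  with c(2) AE_space L_upper show ?thesis unfolding law_of_iterated_log_def
  proof eventually_elim
    case (elim \<omega>)
    note bound = elim(3)
    have "\<forall>\<^sub>F n in sequentially. \<forall>j\<in>{..<r}. \<forall>k\<le>n. \<bar>pos j k \<omega>\<bar> \<le> 4 * B * ?s n"
      using elim(4) by (intro eventually_ball_finite) auto
    with s_pos s_ln have "\<forall>\<^sub>F n in sequentially. ?f \<omega> n \<le> ereal (C * (4 * B + 1))"
    proof eventually_elim
      case (elim n)
      have "real (L n \<omega>) \<le> C * (4 * B * ?s n + ln (real n + 1) + 1)"
        using elim B_pos by (intro bound[rule_format]) auto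
      also have "\<dots> \<le> C * (4 * B * ?s n + ?s n)" using elim C_pos by (intro mult_left_mono) auto
      finally have "real (L n \<omega>) \<le> C * (4 * B + 1) * ?s n" by (simp add: algebra_simps)
      then show ?case
        using elim(1) by (simp only: half[OF elim(1)] divide_le_eq ereal_less_eq if_True)
    qed
    then have "limsup (?f \<omega>) \<le> ereal (C * (4 * B + 1))" by (rule Limsup_bounded)
    then have fin: "limsup (?f \<omega>) < \<infinity>" by (rule order.strict_trans1) simp
    have "ereal (c / K) \<le> limsup (?f \<omega>)"
    proof (rule ccontr)
      assume "\<not> ereal (c / K) \<le> limsup (?f \<omega>)"
      then have "\<forall>\<^sub>F n in sequentially. ?f \<omega> n < ereal (c / K)"
        by (intro Limsup_lessD) (simp only: not_le)
      with s_pos have "\<forall>\<^sub>F n in sequentially. \<not> (c * ?s n \<le> \<bar>pos 0 n \<omega>\<bar>)"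
      proof eventually_elim
        case (elim n)
        then have "real (L n \<omega>) / ?s n < c / K"
          by (simp only: half[OF elim(1)] less_ereal.simps)
        then have "K * real (L n \<omega>) < c * ?s n"
          using K_pos elim(1) by (simp only: pos_divide_less_eq) (simp add: field_simps)
        then show ?case using L_lower[OF \<open>\<omega> \<in> space M\<close>, of n] by linarith
      qed
      with elim(1) show False
        by (simp add: frequently_def cofinite_eq_sequentially)
    qed
    moreover have "0 < ereal (c / K)" using c(1) K_pos by simp
    ultimately have "0 < limsup (?f \<omega>)" by (rule order.strict_trans2[rotated])
    with fin show ?case by blast
  qed
qed

end

section \<open>Random walks on the extension\<close>

lemma (in generated_group) countable_carrier: "countable (carrier G)"
proof (rule countable_subset)
  show "carrier G \<subseteq> word_prod G ` lists S"
  proof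
    fix g assume "g \<in> carrier G"
    from obtain_word[OF this] show "g \<in> word_prod G ` lists S" by (metis imageI in_listsI subsetD)
  qed
  show "countable (word_prod G ` lists S)"
    using finite_gens by (intro countable_image countable_lists countable_finite)
qed

text \<open>Lengths for two generating sets agree up to a factor, so a length would be bounded by
  its own logarithm. This bounds all lengths, and balls are finite.\<close>

lemma (in generated_group) finite_carrier_if_log_bounded:
  assumes T: "generating_set G T" and c: "c > 0"
    and bound: "\<And>g. g \<in> carrier G \<Longrightarrow> real (len g) \<le> c * ln (real (word_length G T g) + 1) + c"
  shows "finite (carrier G)"
proof -
  obtain K where K: "K > 0" "\<And>g. g \<in> carrier G \<Longrightarrow> real (word_length G T g) \<le> K * real (len g)"
    using len_equivalent[OF T] by blast
  have "\<forall>\<^sub>F x in at_top. c * ln (K * x + 1) + c < x"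
    using c K(1) by real_asymp
  then obtain X where X: "\<And>x. x \<ge> X \<Longrightarrow> c * ln (K * x + 1) + c < x"
    by (auto simp: eventually_at_top_linorder)
  have len_le_X: "real (len g) \<le> X" if g: "g \<in> carrier G" for g
  proof (rule ccontr)
    assume "\<not> real (len g) \<le> X"
    then have "c * ln (K * real (len g) + 1) + c < real (len g)" by (intro X) simp
    moreover have "real (len g) \<le> c * ln (real (word_length G T g) + 1) + c" by (rule bound[OF g])
    moreover have "ln (real (word_length G T g) + 1) \<le> ln (K * real (len g) + 1)"
      using K(2)[OF g] by (intro ln_mono) auto
    then have "c * ln (real (word_length G T g) + 1) \<le> c * ln (K * real (len g) + 1)"
      using c by (intro mult_left_mono) auto
    ultimately show False by linarith
  qed
  have "carrier G \<subseteq> word_prod G ` {ws. set ws \<subseteq> S \<and> length ws \<le> nat \<lfloor>X\<rfloor>}"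
  proof
    fix g assume g: "g \<in> carrier G"
    obtain ws where ws: "length ws = len g" "set ws \<subseteq> S" "word_prod G ws = g"
      using obtain_word[OF g] .
    have "len g \<le> nat \<lfloor>X\<rfloor>" using len_le_X[OF g] by linarith
    then show "g \<in> word_prod G ` {ws. set ws \<subseteq> S \<and> length ws \<le> nat \<lfloor>X\<rfloor>}"
      using ws by (intro image_eqI[of _ _ ws]) auto
  qed
  then show ?thesis
    by (rule finite_subset) (intro finite_imageI finite_lists_length_le finite_gens)
qed

lemma torsion_free_finite_trivial:
  assumes "torsion_free_group G" "finite (carrier G)"
  shows "trivial_group G"
proof -
  interpret group G using assms(1) by (simp add: torsion_free_group_def)
  have "Coset.order G > 0" using order_gt_0_iff_finite assms(2) by blast
  then have "x = \<one>\<^bsub>G\<^esub>" if "x \<in> carrier G" for x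
    using that assms(1) pow_order_eq_1[OF that] unfolding torsion_free_group_def by blast
  then have "carrier G = {\<one>\<^bsub>G\<^esub>}" by blast
  then show ?thesis by (simp add: trivial_group_def is_group)
qed

text \<open>Inversion is known to be an involution only on the carrier, so injectivity is argued on
  the support, which inversion preserves.\<close>

lemma (in group) map_inv_symmetric_law:
  assumes "simple_symmetric_law G \<mu>"
  shows "map_pmf (m_inv G) \<mu> = \<mu>"
proof (rule pmf_eqI)
  fix g
  have U: "set_pmf \<mu> \<subseteq> carrier G" "\<And>s. s \<in> set_pmf \<mu> \<Longrightarrow> inv s \<in> set_pmf \<mu>"
    and sym: "\<And>g. g \<in> carrier G \<Longrightarrow> pmf \<mu> g = pmf \<mu> (inv g)"
    using assms unfolding simple_symmetric_law_def generating_set_def by blast+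
  have inj: "inj_on (m_inv G) (set_pmf \<mu>)"
    using U(1) inv_inv by (intro inj_on_inverseI[of _ "m_inv G"]) blast
  show "pmf (map_pmf (m_inv G) \<mu>) g = pmf \<mu> g"
  proof (cases "g \<in> set_pmf \<mu>")
    case True
    then have "pmf (map_pmf (m_inv G) \<mu>) (inv (inv g)) = pmf \<mu> (inv g)"
      using U by (intro pmf_map_inj[OF inj]) auto
    then show ?thesis using True U sym[of g] by auto
  next
    case False
    have "g \<notin> m_inv G ` set_pmf \<mu>" using False U by blast
    then have "pmf (map_pmf (m_inv G) \<mu>) g = 0" by (simp add: pmf_eq_0_set_pmf)
    moreover have "pmf \<mu> g = 0" using False by (simp add: pmf_eq_0_set_pmf)
    ultimately show ?thesis by simp
  qed
qed

context free_abelian_extension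
begin

lemma p_word_prod:
  "j < r \<Longrightarrow> set ws \<subseteq> carrier G \<Longrightarrow>
    real_of_int (p j (word_prod G ws)) = sum_list (map (\<lambda>g. real_of_int (p j g)) ws)"
  by (induction ws) (auto simp: p_one p_mult)

lemma centred_step_coordinate:
  assumes law: "simple_symmetric_law G \<mu>" and j: "j < r"
    and B: "B > 0" "\<And>s. s \<in> set_pmf \<mu> \<Longrightarrow> \<bar>real_of_int (p j s)\<bar> \<le> B"
  shows "centred_step (map_pmf (\<lambda>g. real_of_int (p j g)) \<mu>) B"
proof
  have U: "finite (set_pmf \<mu>)" "set_pmf \<mu> \<subseteq> carrier G"
    using law by (auto simp: simple_symmetric_law_def generating_set_def)
  show "finite (set_pmf (map_pmf (\<lambda>g. real_of_int (p j g)) \<mu>))" using U by simp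
  show "\<bar>x\<bar> \<le> B" if "x \<in> set_pmf (map_pmf (\<lambda>g. real_of_int (p j g)) \<mu>)" for x
    using that B(2) by auto
  have "map_pmf uminus (map_pmf (\<lambda>g. real_of_int (p j g)) \<mu>)
      = map_pmf (\<lambda>g. real_of_int (p j (inv g))) \<mu>"
    unfolding pmf.map_comp using U j by (intro pmf.map_cong0) (auto simp: p_inv)
  also have "\<dots> = map_pmf (\<lambda>g. real_of_int (p j g)) (map_pmf (m_inv G) \<mu>)"
    by (simp add: pmf.map_comp o_def)
  finally show "map_pmf uminus (map_pmf (\<lambda>g. real_of_int (p j g)) \<mu>) = map_pmf (\<lambda>g. real_of_int (p j g)) \<mu>"
    by (simp only: map_inv_symmetric_law[OF law])
qed (rule B(1))

theorem escape_exponent_half: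
  fixes M :: "'w measure"
  assumes law: "simple_symmetric_law G \<mu>" and walk: "random_walk G \<mu> M W"
    and S': "generating_set G S'" and "r > 0"
    and dist: "c > 0" "\<And>h. h \<in> N \<Longrightarrow> real (len h) \<le> c * ln (real (nlen h) + 1) + c"
  shows "escape_exponent G S' M W (1/2)"
proof -
  \<comment> \<open>Three generating sets are in play: \<open>S\<close> measures the distortion,
    \<open>?U\<close> contains the steps, and \<open>S'\<close> measures the walk. \<open>K1\<close>
    and \<open>K2\<close> below compare the first two with \<open>S'\<close>.\<close>
  let ?U = "set_pmf \<mu>"
  have gen_U: "generating_set G ?U" using law by (simp add: simple_symmetric_law_def)
  interpret U: generated_group G ?U by unfold_locales (rule gen_U)
  interpret S': generated_group G S' by unfold_locales (rule S')
  interpret prob_space M using walk by (simp add: random_walk_def)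
  obtain \<xi> where indep: "indep_vars (\<lambda>_. count_space (carrier G)) \<xi> {1..}"
    and \<xi>_law: "\<And>i g. i \<ge> 1 \<Longrightarrow> g \<in> carrier G \<Longrightarrow> prob {\<omega> \<in> space M. \<xi> i \<omega> = g} = pmf \<mu> g"
    and W: "\<And>n \<omega>. \<omega> \<in> space M \<Longrightarrow> W n \<omega> = word_prod G (map (\<lambda>i. \<xi> i \<omega>) [1..<Suc n])"
    using walk unfolding random_walk_def by blast
  interpret \<xi>: iid_sequence M \<xi> \<mu>
    using indep \<xi>_law countable_carrier U.finite_gens U.gens_closed by (rule iid_sequenceI)
  define l where "l n \<omega> = map (\<lambda>i. \<xi> i \<omega>) [1..<Suc n]" for n \<omega>
  have W_l: "W n \<omega> = word_prod G (l n \<omega>)" if "\<omega> \<in> space M" for n \<omega>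
    using W[OF that] by (simp add: l_def)
  have length_l: "length (l n \<omega>) = n" for n \<omega> by (simp add: l_def del: upt_Suc)
  have \<xi>_closed: "\<xi> i \<omega> \<in> carrier G" if "\<omega> \<in> space M" "i \<ge> 1" for i \<omega>
    using indep that measurable_space[of "\<xi> i" M "count_space (carrier G)" \<omega>] by (auto simp: indep_vars_def)
  have l_closed: "set (l n \<omega>) \<subseteq> carrier G" if "\<omega> \<in> space M" for n \<omega>
    using \<xi>_closed[OF that] by (auto simp: l_def simp del: upt_Suc)
  have "AE \<omega> in M. set (l n \<omega>) \<subseteq> ?U" for n
  proof (rule AE_prob_1[THEN AE_mp])
    have "prob {\<omega> \<in> space M. set (l n \<omega>) \<subseteq> ?U} = measure_pmf.prob (replicate_pmf n \<mu>) {xs. set xs \<subseteq> ?U}"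
      unfolding l_def by (rule \<xi>.prefix_law)
    also have "\<dots> = 1"
      by (subst measure_pmf.prob_eq_1) (auto simp: AE_measure_pmf_iff set_replicate_pmf)
    finally show "prob {\<omega> \<in> space M. set (l n \<omega>) \<subseteq> ?U} = 1" .
  qed auto
  then have l_U: "AE \<omega> in M. \<forall>n. set (l n \<omega>) \<subseteq> ?U" by (simp add: AE_all_countable)
  define f where "f j g = real_of_int (p j g)" for j g
  define B where "B = 1 + (\<Sum>s\<in>?U. \<Sum>j<r. \<bar>f j s\<bar>)"
  have B_pos: "B > 0" unfolding B_def by (intro add_pos_nonneg sum_nonneg) auto
  have B: "\<bar>f j s\<bar> \<le> B" if "s \<in> ?U" "j < r" for j s
  proof -
    have "\<bar>f j s\<bar> \<le> (\<Sum>j<r. \<bar>f j s\<bar>)" using that by (intro member_le_sum) auto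
    also have "\<dots> \<le> (\<Sum>s\<in>?U. \<Sum>j<r. \<bar>f j s\<bar>)"
      using that U.finite_gens
      by (intro member_le_sum[of s ?U "\<lambda>s. \<Sum>j<r. \<bar>f j s\<bar>"]) (auto intro: sum_nonneg)
    finally show ?thesis by (simp add: B_def)
  qed
  let ?Y = "\<lambda>j i \<omega>. f j (\<xi> i \<omega>)" and ?\<nu> = "\<lambda>j. map_pmf (f j) \<mu>"
  have step: "centred_step (?\<nu> j) B" if "j < r" for j
    using centred_step_coordinate[OF law that B_pos] B[OF _ that] by (simp add: f_def[abs_def])
  have coord: "centred_walk M (?Y j) (?\<nu> j) B" if "j < r" for j
    by (intro centred_walk.intro step[OF that] \<xi>.iid_map)
  \<comment> \<open>Otherwise the subadditive bound with constant 0 makes the coordinate nonpositive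
    everywhere, although it is 1 at \<open>a 0\<close>.\<close>
  have "\<exists>s\<in>?U. p 0 s \<noteq> 0"
  proof (rule ccontr)
    assume "\<not> (\<exists>s\<in>?U. p 0 s \<noteq> 0)"
    then have "real_of_int (p 0 (a 0)) \<le> 0 * real (U.len (a 0))"
      using \<open>r > 0\<close> by (intro U.subadditive_le_len) (auto simp: p_one p_mult a_closed)
    then show False using \<open>r > 0\<close> by (simp add: p_a)
  qed
  then have nondeg: "nondegenerate_walk M (?Y 0) (?\<nu> 0) B"
    using step[OF \<open>r > 0\<close>]
    by (intro nondegenerate_walk.intro \<xi>.iid_map nondegenerate_step.intro nondegenerate_step_axioms.intro)
       (auto simp: f_def)
  have position: "centred_walk.position (?Y j) k \<omega> = f j (word_prod G (take k (l n \<omega>)))"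
    if "j < r" "\<omega> \<in> space M" "k \<le> n" for j k n \<omega>
  proof -
    interpret centred_walk M "?Y j" "?\<nu> j" B by (rule coord[OF that(1)])
    have take: "take k (l n \<omega>) = l k \<omega>"
      using that(3) by (simp add: l_def take_map take_upt del: upt_Suc)
    have "f j (word_prod G (l k \<omega>)) = sum_list (map (f j) (l k \<omega>))"
      using that l_closed by (simp add: f_def[abs_def] p_word_prod)
    then show ?thesis unfolding take position_def by (simp add: l_def o_def del: upt_Suc)
  qed
  obtain K1 where K1: "K1 > 0" "\<And>g. g \<in> carrier G \<Longrightarrow> real (S'.len g) \<le> K1 * real (len g)"
    using len_equivalent[OF S'] by blast
  obtain K2 where K2: "K2 > 0" "\<And>g. g \<in> carrier G \<Longrightarrow> real (S'.len g) \<le> K2 * real (U.len g)"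
    using U.len_equivalent[OF S'] by blast
  obtain C where C: "C > 0" "\<And>ws R. set ws \<subseteq> ?U \<Longrightarrow>
      (\<And>k j. k \<le> length ws \<Longrightarrow> j < r \<Longrightarrow> \<bar>p j (word_prod G (take k ws))\<bar> \<le> int R) \<Longrightarrow>
      real (len (word_prod G ws)) \<le> C * (real R + ln (real (length ws) + 1) + 1)"
    using len_word_prod_le[OF U.finite_gens U.gens_closed dist] by blast
  obtain K where K: "K > 0" "\<And>g. g \<in> carrier G \<Longrightarrow> \<bar>f 0 g\<bar> \<le> K * real (S'.len g)"
  proof (rule S'.ex_subadditive_le_len[of "\<lambda>g. \<bar>f 0 g\<bar>"])
    show "\<bar>f 0 \<one>\<bar> \<le> 0" using \<open>r > 0\<close> by (simp add: f_def p_one)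
    show "\<bar>f 0 (g \<otimes> h)\<bar> \<le> \<bar>f 0 g\<bar> + \<bar>f 0 h\<bar>" if "g \<in> carrier G" "h \<in> carrier G" for g h
      using \<open>r > 0\<close> that by (simp add: f_def p_mult abs_triangle_ineq)
  qed blast
  let ?L = "\<lambda>n \<omega>. word_length G S' (W n \<omega>)"
  interpret W: controlled_walk M ?Y ?\<nu> B r ?L "K1 * C" K "nat \<lceil>K2\<rceil>"
  proof (intro controlled_walk.intro controlled_walk_axioms.intro prob_space_axioms)
    show "{\<omega> \<in> space M. P (?L n \<omega>)} \<in> events" for P n
    proof -
      have "{\<omega> \<in> space M. P (?L n \<omega>)} = {\<omega> \<in> space M. P (S'.len (word_prod G (l n \<omega>)))}"
        using W_l by auto
      also have "\<dots> \<in> events"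
        unfolding l_def by (rule \<xi>.prefix_events)
      finally show ?thesis .
    qed
    show "AE \<omega> in M. \<forall>R n. 0 \<le> R \<longrightarrow>
        (\<forall>k\<le>n. \<forall>j<r. \<bar>centred_walk.position (?Y j) k \<omega>\<bar> \<le> R) \<longrightarrow>
        real (?L n \<omega>) \<le> K1 * C * (R + ln (real n + 1) + 1)"
      using l_U AE_space
    proof eventually_elim
      case (elim \<omega>)
      show ?case
      proof (intro allI impI)
        fix R :: real and n
        assume R: "0 \<le> R" and bound: "\<forall>k\<le>n. \<forall>j<r. \<bar>centred_walk.position (?Y j) k \<omega>\<bar> \<le> R"
        \<comment> \<open>The coordinates are integers, so \<open>R\<close> may be rounded
          down.\<close>
        have "\<bar>p j (word_prod G (take k (l n \<omega>)))\<bar> \<le> int (nat \<lfloor>R\<rfloor>)" if "k \<le> length (l n \<omega>)" "j < r" for k j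
        proof -
          have "\<bar>f j (word_prod G (take k (l n \<omega>)))\<bar> \<le> R"
            using bound[rule_format, of k j] that elim position[of j \<omega> k n] by (simp add: length_l)
          then have "of_int \<bar>p j (word_prod G (take k (l n \<omega>)))\<bar> \<le> R" by (simp add: f_def)
          then show ?thesis using R by (simp add: le_floor_iff)
        qed
        then have "real (len (word_prod G (l n \<omega>))) \<le> C * (real (nat \<lfloor>R\<rfloor>) + ln (real (length (l n \<omega>)) + 1) + 1)"
          using elim by (intro C(2)) auto
        also have "\<dots> \<le> C * (R + ln (real n + 1) + 1)"
          using C(1) R by (intro mult_left_mono) (auto simp: length_l)
        finally have "K1 * real (len (word_prod G (l n \<omega>))) \<le> K1 * (C * (R + ln (real n + 1) + 1))"
          using K1(1) by (intro mult_left_mono) auto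
        moreover have "real (?L n \<omega>) \<le> K1 * real (len (word_prod G (l n \<omega>)))"
          using elim W_l l_closed by (simp add: K1(2))
        ultimately show "real (?L n \<omega>) \<le> K1 * C * (R + ln (real n + 1) + 1)"
          by (simp add: mult.assoc)
      qed
    qed
    show "\<bar>centred_walk.position (?Y 0) n \<omega>\<bar> \<le> K * real (?L n \<omega>)" if "\<omega> \<in> space M" for n \<omega>
      using position[OF \<open>r > 0\<close> that order.refl] K(2)[of "word_prod G (l n \<omega>)"] l_closed[OF that] W_l[OF that]
      by (simp add: length_l)
    show "AE \<omega> in M. \<forall>n. ?L n \<omega> \<le> nat \<lceil>K2\<rceil> * n"
      using l_U AE_space
    proof eventually_elim
      case (elim \<omega>)
      show ?case
      proof
        fix n
        have "real (?L n \<omega>) \<le> K2 * real (U.len (word_prod G (l n \<omega>)))"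
          using elim W_l l_closed by (simp add: K2(2))
        also have "\<dots> \<le> real (nat \<lceil>K2\<rceil>) * real n"
          using K2(1) U.len_le[of "l n \<omega>"] elim by (intro mult_mono) (auto simp: length_l real_nat_ceiling_ge)
        finally show "?L n \<omega> \<le> nat \<lceil>K2\<rceil> * n" by (simp only: of_nat_mult[symmetric] of_nat_le_iff)
      qed
    qed
    show "?L 0 \<omega> = 0" if "\<omega> \<in> space M" for \<omega> using W[OF that, of 0] by simp
  qed (use \<open>r > 0\<close> coord nondeg K1(1) C(1) K(1) in auto)
  show ?thesis
    unfolding escape_exponent_def using W.tight W.displacement W.iterated_log by blast
qed

end

text \<open>The exact sequence is given by \<open>\<pi>\<close>, an epimorphism onto a product of
  \<open>r\<close> copies of the integers with kernel \<open>N\<close>. On the trivial group the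
  walk never leaves the identity and no lower bound on the displacement can hold.\<close>

theorem theorem1:
  fixes G :: "('a, 'b) monoid_scheme" and N :: "'a set" and r :: nat
    and \<pi> :: "'a \<Rightarrow> nat \<Rightarrow> int"
    and \<mu> :: "'a pmf" and M :: "'w measure" and W :: "nat \<Rightarrow> 'w \<Rightarrow> 'a" and S :: "'a set"
  assumes "torsion_free_group G" and "polycyclic_group G" and "\<not> trivial_group G"
    and "\<pi> \<in> epi G (product_group {..<r} (\<lambda>_. integer_group))"
    and "kernel G (product_group {..<r} (\<lambda>_. integer_group)) \<pi> = N"
    and "finitely_generated_group (G\<lparr>carrier := N\<rparr>)"
    and "nilpotent_group (G\<lparr>carrier := N\<rparr>)"
    and "upper_exp_distortion N G"
    and "simple_symmetric_law G \<mu>"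
    and "random_walk G \<mu> M W"
    and "generating_set G S"
  shows "escape_exponent G S M W (1/2)"
proof -
  interpret group G using assms(1) by (simp add: torsion_free_group_def)
  let ?Z = "product_group {..<r} (\<lambda>_. integer_group)"
  obtain S' T c where S': "generating_set G S'" and T: "generating_set (G\<lparr>carrier := N\<rparr>) T"
    and c: "c > 0" "\<And>h. h \<in> N \<Longrightarrow> real (word_length G S' h) \<le>
      c * ln (real (word_length (G\<lparr>carrier := N\<rparr>) T h) + 1) + c"
    using assms(8) unfolding upper_exp_distortion_def by blast
  interpret S': generated_group G S' by unfold_locales (rule S')
  have hom: "\<pi> \<in> hom G ?Z" and surj: "\<pi> ` carrier G = carrier ?Z"
    using assms(4) by (auto simp: epi_def)
  \<comment> \<open>Elements of the product are functions fixed outside the indices below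
    \<open>r\<close>; this turns vanishing of all coordinates into equality with the neutral
    element.\<close>
  have closed: "\<pi> g \<in> extensional {..<r}" if "g \<in> carrier G" for g
    using hom_in_carrier[OF hom that] by (auto simp: PiE_def)
  have N: "N = {g \<in> carrier G. \<forall>i<r. \<pi> g i = 0}"
    unfolding assms(5)[symmetric] kernel_def
    using closed by (auto simp: one_integer_group fun_eq_iff restrict_def extensional_def)
  show ?thesis
  proof (cases "r = 0")
    case True
    then have "N = carrier G" using N by simp
    then have "finite (carrier G)"
      using S'.finite_carrier_if_log_bounded[of T c] T c by simp
    then show ?thesis using torsion_free_finite_trivial assms(1,3) by blast
  next
    case False
    define a where "a j = (SOME g. g \<in> carrier G \<and> \<pi> g = (\<lambda>i\<in>{..<r}. if i = j then 1 else 0))" for j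
    have a: "a j \<in> carrier G \<and> \<pi> (a j) = (\<lambda>i\<in>{..<r}. if i = j then 1 else 0)" for j
      unfolding a_def
    proof (rule someI_ex)
      have "(\<lambda>i\<in>{..<r}. if i = j then 1 else 0 :: int) \<in> carrier ?Z" by auto
      then show "\<exists>g. g \<in> carrier G \<and> \<pi> g = (\<lambda>i\<in>{..<r}. if i = j then 1 else 0)"
        unfolding surj[symmetric] by (auto simp: image_iff)
    qed
    interpret free_abelian_extension G S' "\<lambda>i g. \<pi> g i" r a N T
    proof
      show "\<pi> (g \<otimes>\<^bsub>G\<^esub> h) i = \<pi> g i + \<pi> h i" if "i < r" "g \<in> carrier G" "h \<in> carrier G" for i g h
        using hom_mult[OF hom that(2,3)] that(1) by simp
    qed (use a N T in auto)
    show ?thesis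
      using False c by (intro escape_exponent_half[OF assms(9-11)]) auto
  qed
qed

end
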